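(* For every fixed polynomial $f\in\mathbb{R}[\lambda]$ there is a constant $C_f$ such that for every odd prime $p$, \[ \left|\frac{1}{|M(\mathbb{F}_p)|}\sum_j f(\lambda_j)-\int_{-2\sqrt2}^{2\sqrt2}f(\lambda)\rho_3(\lambda)\,d\lambda\right|\le\frac{C_f}{p}. \]
   Context: Let $p$ be an odd prime. $M(\mathbb{F}_p)$ denotes the set of triples $(x,y,z)\in\mathbb{F}_p^3\setminus\{(0,0,0)\}$ satisfying $x^2+y^2+z^2=xyz$. The Markoff moves are the maps $m_1(x,y,z)=(yz-x,y,z)$, $m_2(x,y,z)=(x,xz-y,z)$, $m_3(x,y,z)=(x,y,xy-z)$; each is an involution of $M(\mathbb{F}_p)$. The Markoff graph mod $p$ has vertex set $M(\mathbb{F}_p)$ and adjacency matrix $A=P_1+P_2+P_3$, where $P_i$ is the permutation matrix of $m_i$ (i.e. $(P_i)_{uv}=1$ iff $v=m_i(u)$, else $0$). $A$ is a real symmetric matrix with row sums $3$; let $\lambda_j$ denote its eigenvalues listed with multiplicity (they lie in $[-3,3]$). One has $|M(\mathbb{F}_p)|=p^2+3\left(\frac{-1}{p}\right)p$. The Kesten–McKay density for degree 3 is $\rho_3(\lambda)=\frac{3}{2\pi}\frac{\sqrt{8-\lambda^2}}{9-\lambda^2}\mathbf{1}_{[-2\sqrt2,2\sqrt2]}(\lambda)$. *)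

theory Defs
  imports "HOL-Analysis.Analysis" "Jordan_Normal_Form.Char_Poly"
begin

definition markoff :: "int \<Rightarrow> (int \<times> int \<times> int) set" where
  "markoff p = {(x,y,z). x \<in> {0..<p} \<and> y \<in> {0..<p} \<and> z \<in> {0..<p} \<and> (x,y,z) \<noteq> (0,0,0)
      \<and> (x^2 + y^2 + z^2) mod p = (x*y*z) mod p}"

definition m1 :: "int \<Rightarrow> int \<times> int \<times> int \<Rightarrow> int \<times> int \<times> int" where
  "m1 p = (\<lambda>(x,y,z). ((y*z - x) mod p, y, z))"
definition m2 :: "int \<Rightarrow> int \<times> int \<times> int \<Rightarrow> int \<times> int \<times> int" where
  "m2 p = (\<lambda>(x,y,z). (x, (x*z - y) mod p, z))"
definition m3 :: "int \<Rightarrow> int \<times> int \<times> int \<Rightarrow> int \<times> int \<times> int" where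
  "m3 p = (\<lambda>(x,y,z). (x, y, (x*y - z) mod p))"

text \<open>A fixed enumeration of the vertex set (eigenvalues do not depend on it).\<close>
definition markoff_verts :: "int \<Rightarrow> (int \<times> int \<times> int) list" where
  "markoff_verts p = (SOME vs. distinct vs \<and> set vs = markoff p)"

definition perm_matrix :: "int \<Rightarrow> (int \<times> int \<times> int \<Rightarrow> int \<times> int \<times> int) \<Rightarrow> real mat" where
  "perm_matrix p m = (let vs = markoff_verts p; n = length vs in
     Matrix.mat n n (\<lambda>(i,j). if m (vs ! i) = vs ! j then 1 else 0))"

definition markoff_adj :: "int \<Rightarrow> real mat" where
  "markoff_adj p = perm_matrix p (m1 p) + perm_matrix p (m2 p) + perm_matrix p (m3 p)"

definition eig_sum :: "real mat \<Rightarrow> (real \<Rightarrow> real) \<Rightarrow> real" where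
  "eig_sum A f = (\<Sum>t\<in>{t. eigenvalue A t}. real (order t (char_poly A)) * f t)"

definition rho3 :: "real \<Rightarrow> real" where
  "rho3 t = (if t \<in> {-2 * sqrt 2..2 * sqrt 2}
     then 3 / (2*pi) * sqrt (8 - t^2) / (9 - t^2) else 0)"

end

theory Submission
  imports Defs "Jordan_Normal_Form.Schur_Decomposition" "HOL-Number_Theory.Cong"
begin

text \<open>
  Both sides are linear in the polynomial, so it suffices to treat the orthogonal polynomials of the
  Kesten--McKay density. Evaluated at the adjacency matrix, the one of degree \<open>k\<close> has trace
  the number of pairs of a reduced word of length \<open>k\<close> in the three moves and a fixed point of that
  word, because the moves are involutions. Hence for \<open>k > 0\<close> one has to bound the number of fixed
  points of a nonempty reduced word by \<open>O(p)\<close>.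

  The points with nonvanishing coordinates are parametrised by \<open>a = x/z\<close> and \<open>b = y/z\<close>, with
  \<open>x = S/b\<close>, \<open>y = S/a\<close>, \<open>z = S/(a*b)\<close> and \<open>S = a^2 + b^2 + 1\<close>. For fixed \<open>b\<close> the coordinates
  have degrees \<open>(2,1,1)\<close> in \<open>a\<close>, and moves along a reduced word that does not start with the
  first one strictly increase degrees, with leading coefficients staying invertible modulo every
  \<open>p\<close>. So each line \<open>b = const\<close> contains only boundedly many fixed points; words starting with
  the first move are handled by the lines \<open>a = const\<close>.
\<close>

section \<open>Spectral sums of real symmetric matrices as traces\<close>

lemma trace_mult_comm:
  fixes A B :: "'a::comm_ring_1 mat"
  assumes A: "A \<in> carrier_mat n n" and B: "B \<in> carrier_mat n n"
  shows "(\<Sum>i<n. (A * B) $$ (i,i)) = (\<Sum>i<n. (B * A) $$ (i,i))"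
proof -
  have "(\<Sum>i<n. (A * B) $$ (i,i)) = (\<Sum>i<n. \<Sum>j<n. A $$ (i,j) * B $$ (j,i))"
    using A B by (auto simp: scalar_prod_def atLeast0LessThan)
  also have "\<dots> = (\<Sum>j<n. \<Sum>i<n. B $$ (j,i) * A $$ (i,j))"
    by (subst sum.swap) (simp add: mult.commute)
  also have "\<dots> = (\<Sum>i<n. (B * A) $$ (i,i))"
    using A B by (auto simp: scalar_prod_def atLeast0LessThan)
  finally show ?thesis .
qed

lemma upper_triangular_pow:
  fixes B :: "'a::comm_ring_1 mat"
  assumes B: "B \<in> carrier_mat n n" and ut: "upper_triangular B"
  shows "(\<forall>i<n. \<forall>j<i. (B ^\<^sub>m k) $$ (i,j) = 0) \<and> (\<forall>i<n. (B ^\<^sub>m k) $$ (i,i) = (B $$ (i,i)) ^ k)"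
proof (induction k)
  case 0
  then show ?case using B by simp
next
  case (Suc k)
  have C: "B ^\<^sub>m k \<in> carrier_mat n n"
    using B by simp
  have ent: "(B ^\<^sub>m Suc k) $$ (i,j) = (\<Sum>l<n. (B ^\<^sub>m k) $$ (i,l) * B $$ (l,j))"
    if "i < n" "j < n" for i j
    using B C that by (simp add: scalar_prod_def atLeast0LessThan)
  have zB: "B $$ (l,j) = 0" if "j < l" "l < n" for l j
    using upper_triangularD[OF ut] B that by simp
  have "(B ^\<^sub>m Suc k) $$ (i,j) = 0" if "j < i" "i < n" for i j
    unfolding ent[OF that(2) order.strict_trans[OF that]]
  proof (rule sum.neutral, intro ballI)
    fix l assume "l \<in> {..<n}"
    then show "(B ^\<^sub>m k) $$ (i,l) * B $$ (l,j) = 0"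
      using zB[of j l] Suc that by (cases "l < i") simp_all
  qed
  moreover have "(B ^\<^sub>m Suc k) $$ (i,i) = (B $$ (i,i)) ^ Suc k" if "i < n" for i
  proof -
    have "(\<Sum>l<n. (B ^\<^sub>m k) $$ (i,l) * B $$ (l,i))
        = (\<Sum>l<n. if l = i then (B ^\<^sub>m k) $$ (i,i) * B $$ (i,i) else 0)"
    proof (rule sum.cong[OF refl])
      fix l assume "l \<in> {..<n}"
      then show "(B ^\<^sub>m k) $$ (i,l) * B $$ (l,i)
          = (if l = i then (B ^\<^sub>m k) $$ (i,i) * B $$ (i,i) else 0)"
        using zB[of i l] Suc that by (cases l i rule: linorder_cases) simp_all
    qed
    then show ?thesis
      unfolding ent[OF that that] using Suc that by (simp add: mult.commute)
  qed
  ultimately show ?case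
    by blast
qed

text \<open>Pairing an eigenvector with its conjugate gives \<open>t * (v \<bullet>c v)\<close>;
  moving the real symmetric matrix to the other factor gives
  \<open>cnj t * (v \<bullet>c v)\<close>, and the common factor is nonzero.\<close>

lemma real_symmetric_eigenvalue_real:
  fixes A :: "real mat"
  assumes A: "A \<in> carrier_mat n n" and sym: "transpose_mat A = A"
    and ev: "eigenvalue (map_mat complex_of_real A) t"
  shows "t \<in> \<real>"
proof -
  let ?A = "map_mat complex_of_real A"
  have A': "?A \<in> carrier_mat n n"
    using A by simp
  have tr: "transpose_mat ?A = ?A"
    using sym by (metis map_mat_transpose)
  obtain v where v: "v \<in> carrier_vec n" "v \<noteq> 0\<^sub>v n" and eq: "?A *\<^sub>v v = t \<cdot>\<^sub>v v"
    using ev A unfolding eigenvalue_def eigenvector_def by auto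
  have cv: "conjugate v \<in> carrier_vec n"
    using v by simp
  have eq2: "?A *\<^sub>v conjugate v = cnj t \<cdot>\<^sub>v conjugate v"
  proof (rule eq_vecI)
    fix i assume "i < dim_vec (cnj t \<cdot>\<^sub>v conjugate v)"
    then have i: "i < n"
      using v by simp
    have "(?A *\<^sub>v conjugate v) $ i = cnj ((?A *\<^sub>v v) $ i)"
      using A v i by (auto simp: scalar_prod_def)
    also have "\<dots> = (cnj t \<cdot>\<^sub>v conjugate v) $ i"
      unfolding eq using v i by simp
    finally show "(?A *\<^sub>v conjugate v) $ i = (cnj t \<cdot>\<^sub>v conjugate v) $ i" .
  qed (use A v in auto)
  have "t * (v \<bullet>c v) = (?A *\<^sub>v v) \<bullet> conjugate v"
    unfolding eq using v by simp
  also have "\<dots> = v \<bullet> (?A *\<^sub>v conjugate v)"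
    using transpose_vec_mult_scalar[OF A' cv v(1)] tr by simp
  also have "\<dots> = cnj t * (v \<bullet>c v)"
    unfolding eq2 using v by simp
  finally have "t = cnj t"
    using v conjugate_square_eq_0_vec[OF v(1)] by simp
  then show ?thesis
    by (metis Reals_cnj_iff)
qed

text \<open>Over the complex numbers the polynomial splits and its roots are eigenvalues, hence
  real; injectivity of the embedding brings the factorization back to the reals.\<close>

lemma real_symmetric_char_poly_splits:
  fixes A :: "real mat"
  assumes A: "A \<in> carrier_mat n n" and sym: "transpose_mat A = A"
  shows "\<exists>es. char_poly A = (\<Prod>e\<leftarrow>es. [:- e, 1:])"
proof -
  interpret h: map_poly_inj_idom_hom "of_real :: real \<Rightarrow> complex" ..
  let ?A = "map_mat complex_of_real A"
  have A': "?A \<in> carrier_mat n n"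
    using A by simp
  obtain as where as: "char_poly ?A = (\<Prod>a\<leftarrow>as. [:- a, 1:])"
    using char_poly_factorized[OF A'] by blast
  have re: "complex_of_real (Re a) = a" if "a \<in> set as" for a
  proof -
    have "poly (char_poly ?A) a = 0"
      unfolding as using linear_poly_root[OF that] .
    then show ?thesis
      using real_symmetric_eigenvalue_real[OF A sym, of a] eigenvalue_root_char_poly[OF A']
      by (simp add: of_real_Re)
  qed
  have "map_poly complex_of_real (char_poly A) = char_poly ?A"
    by (rule of_real_hom.char_poly_hom[OF A, symmetric])
  also have "\<dots> = (\<Prod>a\<leftarrow>as. map_poly complex_of_real [:- Re a, 1:])"
    unfolding as by (intro arg_cong[of _ _ prod_list] map_cong refl) (use re in auto)
  also have "\<dots> = map_poly complex_of_real (\<Prod>e\<leftarrow>map Re as. [:- e, 1:])"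
    by (simp add: h.hom_prod_list o_def)
  finally have "char_poly A = (\<Prod>e\<leftarrow>map Re as. [:- e, 1:])"
    by (rule h.injectivity)
  then show ?thesis by blast
qed

text \<open>Multiplicities add up over products, so each linear factor contributes one value of
  \<open>f\<close>. A fixed \<open>S\<close> that may contain non-roots, where the order is 0, stays
  the same throughout the induction.\<close>

lemma sum_order_linear_factors:
  fixes es :: "real list" and f :: "real \<Rightarrow> real"
  assumes "finite S" and "set es \<subseteq> S"
  shows "(\<Sum>t\<in>S. real (Polynomial.order t (\<Prod>e\<leftarrow>es. [:- e, 1:])) * f t) = (\<Sum>e\<leftarrow>es. f e)"
  using assms(2)
proof (induction es)
  case Nil
  then show ?case by simp
next
  case (Cons e es)
  let ?q = "\<Prod>e\<leftarrow>es. [:- e, 1:]"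
  have "?q \<noteq> 0"
    unfolding prod_list_zero_iff by auto
  then have nz: "[:- e, 1:] * ?q \<noteq> 0"
    by (intro no_zero_divisors) auto
  have ord: "Polynomial.order t [:- e, 1:] = (if t = e then 1 else 0)" for t :: real
    using order_power_n_n[of e 1] by (cases "t = e") (simp_all add: order_0I)
  have "(\<Sum>t\<in>S. real (Polynomial.order t (\<Prod>e\<leftarrow>e # es. [:- e, 1:])) * f t)
      = (\<Sum>t\<in>S. (if t = e then f t else 0) + real (Polynomial.order t ?q) * f t)"
    unfolding list.map prod_list.Cons order_mult[OF nz] ord
    by (intro sum.cong refl) (auto simp: algebra_simps)
  also have "\<dots> = f e + (\<Sum>e\<leftarrow>es. f e)"
    using Cons assms(1) by (simp add: sum.distrib)
  finally show ?case by simp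
qed

text \<open>The Schur form carries the roots \<open>es\<close> on its diagonal, its powers carry
  their powers, and similar matrices have equal traces.\<close>

theorem eig_sum_power:
  fixes A :: "real mat"
  assumes A: "A \<in> carrier_mat n n" and sym: "transpose_mat A = A"
  shows "eig_sum A (\<lambda>t. t ^ k) = (\<Sum>i<n. (A ^\<^sub>m k) $$ (i,i))"
proof -
  obtain es where es: "char_poly A = (\<Prod>e\<leftarrow>es. [:- e, 1:])"
    using real_symmetric_char_poly_splits[OF A sym] by blast
  obtain B P Q where "schur_decomposition A es = (B, P, Q)"
    by (cases "schur_decomposition A es") auto
  from schur_decomposition[OF A es this]
  have wit: "similar_mat_wit A B P Q" and ut: "upper_triangular B" and diag: "diag_mat B = es"
    by auto
  have pw: "similar_mat_wit (A ^\<^sub>m k) (B ^\<^sub>m k) P Q"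
    by (rule similar_mat_wit_pow[OF wit])
  have C: "A ^\<^sub>m k \<in> carrier_mat n n"
    using A by simp
  note sim = similar_mat_witD2[OF C pw]
  have B: "B \<in> carrier_mat n n"
    using similar_mat_witD2[OF A wit] by blast
  have fin: "finite {t. eigenvalue A t}"
    unfolding eigenvalue_root_char_poly[OF A]
    using degree_monic_char_poly[OF A] by (intro poly_roots_finite) auto
  have sub: "set es \<subseteq> {t. eigenvalue A t}"
    unfolding eigenvalue_root_char_poly[OF A] es using linear_poly_root by blast
  have "eig_sum A (\<lambda>t. t ^ k) = (\<Sum>e\<leftarrow>es. e ^ k)"
    unfolding eig_sum_def es by (rule sum_order_linear_factors[OF fin sub])
  also have "\<dots> = (\<Sum>i<n. (B $$ (i,i)) ^ k)"
    using B unfolding diag[symmetric] diag_mat_def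
    by (simp add: o_def interv_sum_list_conv_sum_set_nat atLeast0LessThan)
  also have "\<dots> = (\<Sum>i<n. (B ^\<^sub>m k) $$ (i,i))"
    using upper_triangular_pow[OF B ut, of k] by simp
  \<comment> \<open>Inserting \<open>Q * P = 1\<close> prepares the cyclic exchange that turns this
    trace into that of \<open>P * B ^\<^sub>m k * Q\<close>.\<close>
  also have "B ^\<^sub>m k = Q * (P * B ^\<^sub>m k)"
    unfolding assoc_mult_mat[OF sim(7,6,5), symmetric] sim(2) by (rule left_mult_one_mat[OF sim(5), symmetric])
  also have "(\<Sum>i<n. (Q * (P * B ^\<^sub>m k)) $$ (i,i)) = (\<Sum>i<n. (P * B ^\<^sub>m k * Q) $$ (i,i))"
    by (rule trace_mult_comm[OF sim(7) mult_carrier_mat[OF sim(6,5)]])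
  also have "P * B ^\<^sub>m k * Q = A ^\<^sub>m k"
    by (rule sim(3)[symmetric])
  finally show ?thesis .
qed

section \<open>Degree growth along reduced words\<close>

definition coord :: "int \<times> int \<times> int \<Rightarrow> nat \<Rightarrow> int" where
  "coord = (\<lambda>(x,y,z) i. if i = 0 then x else if i = 1 then y else z)"

definition markoff_move :: "int \<Rightarrow> nat \<Rightarrow> int \<times> int \<times> int \<Rightarrow> int \<times> int \<times> int" where
  "markoff_move p i = (if i = 0 then m1 p else if i = 1 then m2 p else m3 p)"

text \<open>With \<open>fold\<close> the first letter of the list acts first, so prefixing a letter
  means one more move at the start of the walk.\<close>

definition word_action :: "int \<Rightarrow> nat list \<Rightarrow> int \<times> int \<times> int \<Rightarrow> int \<times> int \<times> int" where
  "word_action p w = fold (markoff_move p) w"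

lemma coord_simps [simp]:
  "coord (x,y,z) 0 = x" "coord (x,y,z) (Suc 0) = y" "coord (x,y,z) 2 = z" "coord (x,y,z) (Suc (Suc 0)) = z"
  by (simp_all add: coord_def)

lemma markoff_move_simps [simp]:
  "markoff_move p 0 (x,y,z) = ((y*z - x) mod p, y, z)"
  "markoff_move p (Suc 0) (x,y,z) = (x, (z*x - y) mod p, z)"
  "markoff_move p 2 (x,y,z) = (x, y, (x*y - z) mod p)"
  by (simp_all add: markoff_move_def m1_def m2_def m3_def mult.commute)

lemma less_three_cases: "i < 3 \<Longrightarrow> i = 0 \<or> i = Suc 0 \<or> i = 2"
  by auto

lemma coord_eqI: "(\<And>j. j < 3 \<Longrightarrow> coord u j = coord v j) \<Longrightarrow> u = v"
proof -
  assume "\<And>j. j < 3 \<Longrightarrow> coord u j = coord v j"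
  from this[of 0] this[of 1] this[of 2] show "u = v"
    by (cases u, cases v) simp
qed

lemma coord_markoff_move:
  assumes "i < 3"
  shows "coord (markoff_move p i u) i = (coord u ((i+1) mod 3) * coord u ((i+2) mod 3) - coord u i) mod p"
    and "j < 3 \<Longrightarrow> j \<noteq> i \<Longrightarrow> coord (markoff_move p i u) j = coord u j"
proof -
  obtain x y z where [simp]: "u = (x,y,z)"
    by (cases u)
  show "coord (markoff_move p i u) i = (coord u ((i+1) mod 3) * coord u ((i+2) mod 3) - coord u i) mod p"
    using less_three_cases[OF assms] by (elim disjE) simp_all
  show "coord (markoff_move p i u) j = coord u j" if "j < 3" "j \<noteq> i"
    using less_three_cases[OF assms] less_three_cases[OF that(1)] that(2) by (elim disjE) simp_all
qed

lemma markoff_coord_range: "u \<in> markoff p \<Longrightarrow> coord u j \<in> {0..<p}"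
  by (auto simp: markoff_def coord_def)

lemma markoff_coord_cong:
  assumes "u \<in> markoff p" "j < 3"
  shows "[(coord u j)^2 + (coord u ((j+1) mod 3))^2 + (coord u ((j+2) mod 3))^2
     = coord u j * coord u ((j+1) mod 3) * coord u ((j+2) mod 3)] (mod p)"
proof -
  obtain x y z where u: "u = (x,y,z)"
    by (cases u)
  have "[x^2 + y^2 + z^2 = x*y*z] (mod p)"
    using assms(1) unfolding u by (simp add: markoff_def cong_def)
  then show ?thesis
    using less_three_cases[OF assms(2)] unfolding u by (elim disjE) (simp_all add: ac_simps)
qed

lemma finite_markoff: "finite (markoff p)"
  by (rule finite_subset[of _ "{0..<p} \<times> {0..<p} \<times> {0..<p}"]) (auto simp: markoff_def)

lemma cong_range_eq:
  fixes x y p :: int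
  assumes "[x = y] (mod p)" "x \<in> {0..<p}" "y \<in> {0..<p}"
  shows "x = y"
  using assms by (auto simp: cong_def)

text \<open>The equation is quadratic in each coordinate, and the move exchanges its two roots,
  whose sum is the product of the other two coordinates.\<close>

lemma markoff_move_closed:
  assumes u: "u \<in> markoff p" and i: "i < 3"
  shows "markoff_move p i u \<in> markoff p \<and> markoff_move p i (markoff_move p i u) = u"
proof -
  have ivo: "markoff_move p i (markoff_move p i u) = u"
  proof (rule coord_eqI)
    fix j :: nat assume j: "j < 3"
    show "coord (markoff_move p i (markoff_move p i u)) j = coord u j"
    proof (cases "j = i")
      case True
      have ne: "(i+1) mod 3 \<noteq> i" "(i+2) mod 3 \<noteq> i"
        using i by presburger+
      show ?thesis
        unfolding True coord_markoff_move(1)[OF i] using ne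
        by (simp add: coord_markoff_move(2)[OF i] mod_diff_right_eq)
           (use markoff_coord_range[OF u, of i] in auto)
    qed (use coord_markoff_move(2)[OF i j] in auto)
  qed
  obtain x y z where [simp]: "u = (x,y,z)"
    by (cases u)
  have u': "x \<in> {0..<p}" "y \<in> {0..<p}" "z \<in> {0..<p}"
    "[x^2+y^2+z^2 = x*y*z] (mod p)"
    using u by (auto simp: markoff_def cong_def)
  have p: "p > 0"
    using u' by auto
  \<comment> \<open>The origin is fixed by every move, so by involutivity only the origin is sent to
    it.\<close>
  have nz: "markoff_move p i u \<noteq> (0,0,0)"
  proof
    assume z: "markoff_move p i u = (0,0,0)"
    have "markoff_move p i (0,0,0) = (0,0,0)"
      using less_three_cases[OF i] by (elim disjE) simp_all
    then have "u = (0,0,0)"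
      using ivo z by simp
    then show False
      using u by (auto simp: markoff_def)
  qed
  have red: "[((y*z-x) mod p)^2+y^2+z^2 = ((y*z-x) mod p)*y*z] (mod p)"
    if "[x^2+y^2+z^2 = x*y*z] (mod p)" for x y z :: int
  proof -
    have eq: "(y*z-x)^2+y^2+z^2 - (y*z-x)*y*z = x^2+y^2+z^2 - x*y*z"
      by (simp add: algebra_simps power2_eq_square)
    have "[(y*z-x)^2+y^2+z^2 = (y*z-x)*y*z] (mod p)"
      using that unfolding cong_iff_dvd_diff eq .
    moreover have "[(y*z-x) mod p = y*z-x] (mod p)"
      by (simp add: cong_def)
    then have "[((y*z-x) mod p)^2+y^2+z^2 = (y*z-x)^2+y^2+z^2] (mod p)"
      "[((y*z-x) mod p)*y*z = (y*z-x)*y*z] (mod p)"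
      by (intro cong_add cong_mult cong_pow cong_refl; assumption)+
    ultimately show ?thesis
      by (meson cong_sym cong_trans)
  qed
  \<comment> \<open>The equation is symmetric, so rotating the coordinates reduces the other two
    moves to \<open>red\<close>, which treats the first.\<close>
  have perm1: "[y^2+z^2+x^2 = y*z*x] (mod p)" and perm2: "[z^2+x^2+y^2 = z*x*y] (mod p)"
    using u'(4) by (simp_all add: ac_simps)
  have "markoff_move p i u \<in> markoff p"
    using less_three_cases[OF i]
  proof (elim disjE)
    assume [simp]: "i = 0"
    show ?thesis
      using red[OF u'(4)] nz u' p by (simp add: markoff_def cong_def)
  next
    assume [simp]: "i = Suc 0"
    show ?thesis
      using red[OF perm1] nz u' p by (auto simp: markoff_def cong_def ac_simps)
  next
    assume [simp]: "i = 2"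
    show ?thesis
      using red[OF perm2] nz u' p by (auto simp: markoff_def cong_def ac_simps)
  qed
  then show ?thesis
    using ivo by blast
qed

text \<open>Lagrange's bound, proved over the integers by splitting off \<open>t - r\<close>; the
  hypothesis on the leading coefficient says that the degree does not drop modulo
  \<open>p\<close>.\<close>

lemma card_roots_mod_prime:
  fixes p :: int and P :: "int poly"
  assumes p: "prime p" and lc: "\<not> p dvd lead_coeff P"
  shows "card {t\<in>{0..<p}. p dvd poly P t} \<le> degree P"
  using lc
proof (induction "degree P" arbitrary: P)
  case 0
  then obtain a where "P = [:a:]"
    by (metis degree_eq_zeroE)
  with 0 show ?case by simp
next
  case (Suc n)
  show ?case
  proof (cases "\<exists>r\<in>{0..<p}. p dvd poly P r")
    case False
    then have "{t\<in>{0..<p}. p dvd poly P t} = {}" by blast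
    then show ?thesis by (metis card.empty le0)
  next
    case True
    then obtain r where r: "r \<in> {0..<p}" "p dvd poly P r" by blast
    define Q where "Q = synthetic_div P r"
    have PQ: "P = [:-r,1:] * Q + [:poly P r:]"
      unfolding Q_def by (rule synthetic_div_correct'[symmetric])
    have dQ: "degree Q = n"
      unfolding Q_def using Suc(2) by (simp add: degree_synthetic_div)
    have "coeff P (Suc n) = coeff Q n"
      by (subst PQ) (use dQ in \<open>simp add: coeff_eq_0\<close>)
    then have "\<not> p dvd lead_coeff Q"
      using Suc(2,3) dQ by simp
    then have IH: "card {t\<in>{0..<p}. p dvd poly Q t} \<le> n"
      using Suc(1)[of Q] dQ by simp
    have "{t\<in>{0..<p}. p dvd poly P t} \<subseteq> insert r {t\<in>{0..<p}. p dvd poly Q t}"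
    proof
      fix t assume t: "t \<in> {t\<in>{0..<p}. p dvd poly P t}"
      have "poly P t = (t - r) * poly Q t + poly P r"
        by (subst PQ) (simp add: algebra_simps)
      then have "p dvd (t - r) * poly Q t"
        using t r by (metis (no_types, lifting) dvd_add_left_iff mem_Collect_eq)
      then have "p dvd t - r \<or> p dvd poly Q t"
        using p by (simp add: prime_dvd_mult_iff)
      moreover have "t = r" if "p dvd t - r"
        using that t r by (intro cong_range_eq[of t r p]) (auto simp: cong_iff_dvd_diff)
      ultimately show "t \<in> insert r {t\<in>{0..<p}. p dvd poly Q t}"
        using t by auto
    qed
    then have "card {t\<in>{0..<p}. p dvd poly P t} \<le> card (insert r {t\<in>{0..<p}. p dvd poly Q t})"
      by (rule card_mono[rotated]) (intro finite.insertI finite_Collect_conjI disjI1; simp)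
    also have "\<dots> \<le> Suc n"
      using card_insert_le_m1[of "Suc n" "{t\<in>{0..<p}. p dvd poly Q t}" r] IH by simp
    finally show ?thesis
      using Suc(2) by simp
  qed
qed

lemma card_le_fibers:
  assumes T: "finite T" and sub: "f ` S \<subseteq> T"
    and fib: "\<And>t. t \<in> T \<Longrightarrow> card {s\<in>S. f s = t} \<le> K"
  shows "card S \<le> K * card T"
proof -
  have "card S = card (\<Union>t\<in>T. {s\<in>S. f s = t})"
    using sub by (intro arg_cong[of _ _ card]) auto
  also have "\<dots> \<le> (\<Sum>t\<in>T. card {s\<in>S. f s = t})"
    by (rule card_UN_le[OF T])
  also have "\<dots> \<le> (\<Sum>t\<in>T. K)"
    by (intro sum_mono fib)
  finally show ?thesis
    by (simp add: mult.commute)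
qed

lemma degree_lead_coeff_diff:
  fixes A B :: "'a::ring_1 poly"
  assumes "degree B < degree A"
  shows "degree (A - B) = degree A" "lead_coeff (A - B) = lead_coeff A"
proof -
  show d: "degree (A - B) = degree A"
    using degree_add_eq_left[of "- B" A] assms by simp
  show "lead_coeff (A - B) = lead_coeff A"
    unfolding d using assms by (simp add: coeff_eq_0)
qed

text \<open>Here \<^term>\<open>P j\<close> is the numerator of the \<^term>\<open>j\<close>-th coordinate over the
  denominator \<^term>\<open>(c*t)^N\<close>, as a polynomial in the parameter \<^term>\<open>t\<close>; so
  \<^term>\<open>d j\<close> is its degree as a rational function. As long as the coordinate
  of largest degree was the last to be changed, each further move strictly increases the degree of
  the coordinate it changes.\<close>

lemma word_growth:
  fixes P :: "nat \<Rightarrow> int poly" and d :: "nat \<Rightarrow> nat"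
  assumes p: "prime p" and c: "\<not> p dvd c"
    and "i < 3" "set w \<subseteq> {..<3}" "distinct_adj (i # w)"
    and "\<And>j. j < 3 \<Longrightarrow> degree (P j) = N + d j"
    and "\<And>j. j < 3 \<Longrightarrow> \<not> p dvd lead_coeff (P j)"
    and "\<And>j. j < 3 \<Longrightarrow> 0 < d j \<and> d j \<le> K"
    and "d i = d ((i+1) mod 3) + d ((i+2) mod 3)"
  shows "\<exists>P' d'. (\<forall>j<3. degree (P' j) = N * 2 ^ length w + d' j \<and> \<not> p dvd lead_coeff (P' j)
        \<and> d j \<le> d' j \<and> d' j \<le> K * 2 ^ length w)
      \<and> (w \<noteq> [] \<longrightarrow> (\<exists>j<3. d j < d' j))
      \<and> (\<forall>t u. (\<forall>j<3. [(c*t)^N * coord u j = poly (P j) t] (mod p)) \<longrightarrow>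
           (\<forall>j<3. [(c*t)^(N * 2 ^ length w) * coord (word_action p w u) j = poly (P' j) t] (mod p)))"
  using assms(3-)
proof (induction w arbitrary: i P N d K)
  case Nil
  then show ?case
    by (intro exI[of _ P] exI[of _ d]) (simp add: word_action_def)
next
  case (Cons k w)
  note deg = Cons.prems(4) and lc = Cons.prems(5) and pos = Cons.prems(6) and dmax = Cons.prems(7)
  have k: "k < 3" "k \<noteq> i" and i: "i < 3"
    using Cons.prems by auto
  define a b where "a = (k+1) mod 3" and "b = (k+2) mod 3"
  have ab: "a < 3" "b < 3" "a \<noteq> k" "b \<noteq> k"
    using k(1) unfolding a_def b_def by presburger+
  \<comment> \<open>The letter \<open>k\<close> differs from \<open>i\<close>, so coordinate
    \<open>i\<close> is one of the two factors. Its degree is that of \<open>k\<close> plus that of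
    the third coordinate, so the product outgrows coordinate \<open>k\<close>.\<close>
  have "a = i \<and> b = (i+1) mod 3 \<and> k = (i+2) mod 3 \<or> b = i \<and> a = (i+2) mod 3 \<and> k = (i+1) mod 3"
    using less_three_cases[OF k(1)] less_three_cases[OF i] k(2) unfolding a_def b_def
    by (elim disjE; simp add: mod_Suc)
  then have grow: "d k < d a + d b"
    using dmax pos[OF ab(1)] pos[OF ab(2)] by auto
  define X where "X = [:0,c:] ^ N"
  have cnz: "c \<noteq> 0"
    using c by auto
  have "lead_coeff X = c ^ N"
    unfolding X_def lead_coeff_power using cnz by simp
  then have X: "\<not> p dvd lead_coeff X"
    using c p prime_dvd_power by auto
  have X0: "degree X = N" "X \<noteq> 0"
    unfolding X_def using cnz by (simp_all add: degree_power_eq)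
  have pX: "poly X t = (c*t)^N" for t
    unfolding X_def by (simp add: mult.commute)
  have nz: "P j \<noteq> 0" if "j < 3" for j
    using lc[OF that] by auto
  have degm: "degree (P a * P b) = 2 * N + (d a + d b)"
    unfolding degree_mult_eq[OF nz[OF ab(1)] nz[OF ab(2)]] using deg ab by simp
  have lcm: "\<not> p dvd lead_coeff (P a * P b)"
    unfolding lead_coeff_mult prime_dvd_mult_iff[OF p] using lc ab by blast
  have degX: "degree (X * P j) = 2 * N + d j" if "j < 3" for j
    unfolding degree_mult_eq[OF X0(2) nz[OF that]] using deg[OF that] X0 by simp
  have lcX: "\<not> p dvd lead_coeff (X * P j)" if "j < 3" for j
    unfolding lead_coeff_mult prime_dvd_mult_iff[OF p] using lc[OF that] X by blast
  have lt: "degree (X * P k) < degree (P a * P b)"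
    unfolding degm degX[OF k(1)] using grow by simp
  \<comment> \<open>A product of two coordinates has denominator \<open>(c*t)^(2*N)\<close>, so
    every other numerator is multiplied by \<open>X\<close>; the exponent doubles with each
    letter.\<close>
  define Q where "Q = (\<lambda>j. if j = k then P a * P b - X * P k else X * P j)"
  define e where "e = (\<lambda>j. if j = k then d a + d b else d j)"
  have Q: "degree (Q j) = 2 * N + e j" "\<not> p dvd lead_coeff (Q j)" if "j < 3" for j
    using degree_lead_coeff_diff[OF lt] degm degX[OF that] lcm lcX[OF that]
    unfolding Q_def e_def by (auto simp del: coeff_diff)
  have e: "0 < e j \<and> e j \<le> 2 * K" if "j < 3" for j
    using pos[OF that] pos[OF ab(1)] pos[OF ab(2)] unfolding e_def by auto
  \<comment> \<open>Coordinate \<open>k\<close> takes over the role of \<open>i\<close> for the rest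
    of the word.\<close>
  have emax: "e k = e ((k+1) mod 3) + e ((k+2) mod 3)"
    using ab unfolding e_def a_def[symmetric] b_def[symmetric] by auto
  have adj: "distinct_adj (k # w)" and sw: "set w \<subseteq> {..<3}"
    using Cons.prems by auto
  obtain P' d' where
    P': "\<forall>j<3. degree (P' j) = 2 * N * 2 ^ length w + d' j \<and> \<not> p dvd lead_coeff (P' j)
        \<and> e j \<le> d' j \<and> d' j \<le> 2 * K * 2 ^ length w"
    and rep: "\<And>t u. (\<forall>j<3. [(c*t)^(2*N) * coord u j = poly (Q j) t] (mod p)) \<Longrightarrow>
           (\<forall>j<3. [(c*t)^(2 * N * 2 ^ length w) * coord (word_action p w u) j = poly (P' j) t] (mod p))"
    using Cons.IH[OF k(1) sw adj Q e emax] by blast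
  have step: "[(c*t)^(2*N) * coord (markoff_move p k u) j = poly (Q j) t] (mod p)"
    if j: "j < 3" and u: "\<forall>j<3. [(c*t)^N * coord u j = poly (P j) t] (mod p)" for t u j
  proof (cases "j = k")
    case True
    define q where "q = (c*t)^N"
    have q: "[q * coord u a = poly (P a) t] (mod p)" "[q * coord u b = poly (P b) t] (mod p)"
      "[q * coord u k = poly (P k) t] (mod p)"
      using u ab k unfolding q_def by auto
    have "[q^2 * ((coord u a * coord u b - coord u k) mod p)
        = q^2 * (coord u a * coord u b - coord u k)] (mod p)"
      by (intro cong_mult cong_refl) (simp add: cong_def)
    also have "q^2 * (coord u a * coord u b - coord u k)
      = (q * coord u a) * (q * coord u b) - q * (q * coord u k)"
      by (simp add: algebra_simps power2_eq_square)
    also have "[\<dots> = poly (P a) t * poly (P b) t - q * poly (P k) t] (mod p)"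
      by (intro cong_diff cong_mult cong_refl q)
    finally show ?thesis
      unfolding True coord_markoff_move(1)[OF k(1)] a_def[symmetric] b_def[symmetric] Q_def
      by (simp add: pX q_def power_mult mult.commute[of 2 N])
  next
    case False
    have "[(c*t)^N * ((c*t)^N * coord u j) = (c*t)^N * poly (P j) t] (mod p)"
      using u j by (intro cong_mult cong_refl) auto
    then show ?thesis
      unfolding coord_markoff_move(2)[OF k(1) j False] Q_def using False
      by (simp add: pX mult_2 power_add mult.assoc)
  qed
  show ?case
  proof (intro exI[of _ P'] exI[of _ d'] conjI impI allI)
    show "\<exists>j<3. d j < d' j"
      using P' k(1) grow unfolding e_def by (intro exI[of _ k]) (auto intro: less_le_trans)
  next
    fix t u j
    assume u: "\<forall>j<3. [(c*t)^N * coord u j = poly (P j) t] (mod p)" and j: "j < (3::nat)"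
    have "[(c*t)^(2 * N * 2 ^ length w) * coord (word_action p w (markoff_move p k u)) j = poly (P' j) t] (mod p)"
      using rep[of t "markoff_move p k u"] step[OF _ u] j by blast
    then show "[(c*t)^(N * 2 ^ length (k # w)) * coord (word_action p (k # w) u) j = poly (P' j) t] (mod p)"
      by (simp add: word_action_def mult.assoc mult.left_commute)
  next
    fix j :: nat assume j: "j < 3"
    have "d j \<le> e j"
      unfolding e_def using grow by auto
    then show "d j \<le> d' j"
      using P' j by (meson order.trans)
  qed (use P' in \<open>auto simp: mult.assoc mult.left_commute\<close>)
qed

section \<open>Counting points on the Markoff surface\<close>

lemma finite_residues: "finite {t\<in>{0..<p::int}. Q t}"
  by (rule finite_subset[of _ "{0..<p}"]) auto

text \<open>The two coordinates of the chart are interchangeable, and the one serving as parameter is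
  chosen so that the coordinate \<^term>\<open>i\<close> of largest degree differs from the first letter
  of the word.\<close>

lemma fixed_points_on_line:
  fixes p c :: int
  assumes p: "prime p" and c: "\<not> p dvd c" and i: "i < 2"
    and w: "w \<noteq> []" "set w \<subseteq> {..<3}" "distinct_adj (i # w)"
  shows "card {t\<in>{0..<p}. \<exists>u. word_action p w u = u
      \<and> [c*t*coord u i = t*(t^2+c^2+1)] (mod p)
      \<and> [c*t*coord u (1-i) = c*(t^2+c^2+1)] (mod p)
      \<and> [c*t*coord u 2 = t^2+c^2+1] (mod p)} \<le> 3 * 2 ^ length w"
proof -
  define L :: nat where "L = 2 ^ length w"
  have L: "0 < L"
    unfolding L_def by simp
  \<comment> \<open>Over the denominator \<open>c*t\<close> the numerators are \<open>t*S\<close>,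
    \<open>c*S\<close> and \<open>S\<close>; with \<open>N = 1\<close> the degrees as rational
    functions are 2, 1 and 1.\<close>
  define S where "S = [:c^2+1, 0, 1:]"
  define P where "P = (\<lambda>j. if j = i then pCons 0 S else if j = 1 - i then Polynomial.smult c S else S)"
  define d where "d = (\<lambda>j. if j = i then 2 else 1::nat)"
  have cnz: "c \<noteq> 0"
    using c by auto
  have np: "\<not> is_unit p"
    using p by auto
  have degP: "degree (P j) = 1 + d j" if "j < 3" for j
    unfolding P_def d_def S_def using cnz i by auto
  have lcP: "\<not> p dvd lead_coeff (P j)" if "j < 3" for j
    unfolding P_def S_def using cnz c np by auto
  have idx: "(i + 1) mod 3 \<noteq> i" "(i + 2) mod 3 \<noteq> i"
    using i by presburger+
  have dmax: "d i = d ((i+1) mod 3) + d ((i+2) mod 3)" and i3: "i < 3"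
    using idx i unfolding d_def by simp_all
  have dpos: "0 < d j \<and> d j \<le> 2" if "j < 3" for j
    unfolding d_def by simp
  obtain P' d' where
    P': "\<forall>j<3. degree (P' j) = 1 * 2 ^ length w + d' j \<and> \<not> p dvd lead_coeff (P' j)
        \<and> d j \<le> d' j \<and> d' j \<le> 2 * 2 ^ length w"
    and ex: "w \<noteq> [] \<longrightarrow> (\<exists>j<3. d j < d' j)"
    and rep: "\<And>t u. (\<forall>j<3. [(c*t)^1 * coord u j = poly (P j) t] (mod p)) \<Longrightarrow>
           (\<forall>j<3. [(c*t)^(1 * 2 ^ length w) * coord (word_action p w u) j = poly (P' j) t] (mod p))"
    using word_growth[OF p c i3 w(2,3) degP lcP dpos dmax] by blast
  obtain j where j: "j < 3" "d j < d' j"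
    using ex w by blast
  \<comment> \<open>For a fixed point both \<open>P j\<close> and \<open>P' j\<close> are numerators
    of coordinate \<open>j\<close>; the factor \<open>X\<close> raises the denominator of the first
    from \<open>c*t\<close> to \<open>(c*t)^L\<close>.\<close>
  define X where "X = [:0,c:] ^ (L - 1)"
  have X: "degree X = L - 1" "X \<noteq> 0"
    unfolding X_def using cnz by (simp_all add: degree_power_eq)
  have Pj: "P j \<noteq> 0"
    using lcP[OF j(1)] by auto
  have degX: "degree (X * P j) = L + d j"
    unfolding degree_mult_eq[OF X(2) Pj] using X L degP[OF j(1)] by simp
  \<comment> \<open>Since coordinate \<open>j\<close> gained degree, the difference \<open>Q\<close>
    keeps the degree of \<open>P' j\<close>, at most \<open>L + 2 * L\<close>, and its leading
    coefficient. Fixed points give roots of \<open>Q\<close>.\<close>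
  have lt: "degree (X * P j) < degree (P' j)"
    unfolding degX using P' j unfolding L_def by simp
  define Q where "Q = P' j - X * P j"
  have Q: "degree Q = degree (P' j)" "\<not> p dvd lead_coeff Q"
    using degree_lead_coeff_diff[OF lt] P' j unfolding Q_def by auto
  let ?A = "{t\<in>{0..<p}. \<exists>u. word_action p w u = u
      \<and> [c*t*coord u i = t*(t^2+c^2+1)] (mod p)
      \<and> [c*t*coord u (1-i) = c*(t^2+c^2+1)] (mod p)
      \<and> [c*t*coord u 2 = t^2+c^2+1] (mod p)}"
  have "?A \<subseteq> {t\<in>{0..<p}. p dvd poly Q t}"
  proof
    fix t assume "t \<in> ?A"
    then obtain u where t: "t \<in> {0..<p}" and fx: "word_action p w u = u" and
      u: "[c*t*coord u i = t*(t^2+c^2+1)] (mod p)"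
      "[c*t*coord u (1-i) = c*(t^2+c^2+1)] (mod p)"
      "[c*t*coord u 2 = t^2+c^2+1] (mod p)"
      by blast
    have S: "poly S t = t^2+c^2+1"
      unfolding S_def by (simp add: power2_eq_square algebra_simps)
    have rep0: "\<forall>j<3. [(c*t)^1 * coord u j = poly (P j) t] (mod p)"
    proof (intro allI impI)
      fix j :: nat assume "j < 3"
      then have "j = i \<or> j = 1 - i \<and> j \<noteq> i \<or> j = 2 \<and> j \<noteq> i \<and> j \<noteq> 1 - i"
        using i by auto
      then show "[(c*t)^1 * coord u j = poly (P j) t] (mod p)"
        using u unfolding P_def by (elim disjE) (simp_all add: S)
    qed
    have 1: "[(c*t)^L * coord u j = poly (P' j) t] (mod p)"
      using rep[OF rep0] fx j unfolding L_def by simp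
    have "[(c*t)^(L-1) * ((c*t)^1 * coord u j) = (c*t)^(L-1) * poly (P j) t] (mod p)"
      using rep0 j by (intro cong_mult cong_refl) blast
    moreover have "(c*t)^(L-1) * ((c*t)^1 * coord u j) = (c*t)^L * coord u j"
      using L by (simp add: power_eq_if)
    ultimately have "[poly (P' j) t = (c*t)^(L-1) * poly (P j) t] (mod p)"
      using 1 by (metis cong_sym cong_trans)
    moreover have "poly Q t = poly (P' j) t - (c*t)^(L-1) * poly (P j) t"
      unfolding Q_def X_def by (simp add: mult.commute)
    ultimately show "t \<in> {t\<in>{0..<p}. p dvd poly Q t}"
      using t by (simp add: cong_iff_dvd_diff)
  qed
  then have "card ?A \<le> card {t\<in>{0..<p}. p dvd poly Q t}"
    by (rule card_mono[OF finite_residues])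
  also have "\<dots> \<le> degree Q"
    by (rule card_roots_mod_prime[OF p Q(2)])
  also have "\<dots> \<le> 3 * 2 ^ length w"
    using Q P' j by simp
  finally show ?thesis .
qed

section \<open>Charting the points with nonvanishing coordinates\<close>

lemma inverse_mod_prime:
  fixes p :: int
  assumes "prime p"
  obtains iz where "\<And>z. \<not> p dvd z \<Longrightarrow> [z * iz z = 1] (mod p)"
proof -
  have "\<exists>y. [z * y = 1] (mod p)" if "\<not> p dvd z" for z
    using that assms by (metis cong_solve_coprime_int coprime_commute prime_imp_coprime)
  then show ?thesis
    using that by metis
qed

lemma not_dvd_residue:
  fixes p x :: int
  shows "x \<in> {0..<p} \<Longrightarrow> x \<noteq> 0 \<Longrightarrow> \<not> p dvd x"
  using zdvd_not_zless[of x p] by auto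

text \<open>Dividing the equation by \<open>z^2\<close>, with \<open>z'\<close> as inverse of
  \<open>z\<close>, gives \<open>a^2+b^2+1 = a*b*z\<close>; here \<open>a*z\<close> is
  \<open>x\<close> and \<open>b*z\<close> is \<open>y\<close>.\<close>

lemma chart_equations:
  fixes p x y z z' :: int
  assumes "[x^2+y^2+z^2 = x*y*z] (mod p)" and "[z * z' = 1] (mod p)"
  defines "a \<equiv> x * z' mod p" and "b \<equiv> y * z' mod p"
  shows "[x = a*z] (mod p)" "[y = b*z] (mod p)"
    and "[b*x = a^2+b^2+1] (mod p)" "[a*y = a^2+b^2+1] (mod p)" "[a*b*z = a^2+b^2+1] (mod p)"
proof -
  have a: "[a = x * z'] (mod p)" and b: "[b = y * z'] (mod p)"
    unfolding a_def b_def by (simp_all add: cong_def)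
  have xa: "[a * z = x] (mod p)"
  proof -
    have "[a * z = x * z' * z] (mod p)"
      by (intro cong_mult a cong_refl)
    also have "x * z' * z = x * (z * z')"
      by (simp add: ac_simps)
    also have "[\<dots> = x * 1] (mod p)"
      by (intro cong_mult assms(2) cong_refl)
    finally show ?thesis by simp
  qed
  have yb: "[b * z = y] (mod p)"
  proof -
    have "[b * z = y * z' * z] (mod p)"
      by (intro cong_mult b cong_refl)
    also have "y * z' * z = y * (z * z')"
      by (simp add: ac_simps)
    also have "[\<dots> = y * 1] (mod p)"
      by (intro cong_mult assms(2) cong_refl)
    finally show ?thesis by simp
  qed
  have S: "[a^2+b^2+1 = a*b*z] (mod p)"
  proof -
    have "[a^2+b^2+1 = (x*z')^2+(y*z')^2+(z*z')^2] (mod p)"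
      using cong_pow[OF cong_sym[OF assms(2)], of 2]
      by (intro cong_add cong_pow a b) simp
    also have "(x*z')^2+(y*z')^2+(z*z')^2 = (x^2+y^2+z^2) * z'^2"
      by (simp add: algebra_simps)
    also have "[\<dots> = x*y*z*z'^2] (mod p)"
      by (intro cong_mult assms(1) cong_refl)
    also have "x*y*z*z'^2 = (x*z')*(y*z')*z"
      by (simp add: power2_eq_square)
    also have "[\<dots> = a*b*z] (mod p)"
      by (intro cong_mult cong_sym[OF a] cong_sym[OF b] cong_refl)
    finally show ?thesis .
  qed
  show "[x = a*z] (mod p)" "[y = b*z] (mod p)"
    using xa yb by (simp_all add: cong_sym)
  show "[a*b*z = a^2+b^2+1] (mod p)"
    by (rule cong_sym[OF S])
  have "[b*(a*z) = b*x] (mod p)" "[a*(b*z) = a*y] (mod p)"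
    by (intro cong_mult cong_refl xa yb)+
  moreover have "b*(a*z) = a*b*z" "a*(b*z) = a*b*z"
    by simp_all
  ultimately show "[b*x = a^2+b^2+1] (mod p)" "[a*y = a^2+b^2+1] (mod p)"
    using S cong_sym cong_trans by metis+
qed

text \<open>With one coordinate zero, the squares of the other two add up to zero, so each value of
  the second leaves at most two values of the third.\<close>

lemma card_zero_coord:
  fixes p :: int
  assumes p: "prime p" and j: "j < 3"
  shows "card {u\<in>markoff p. coord u j = 0} \<le> 2 * nat p"
proof -
  define k l where "k = (j+1) mod 3" and "l = (j+2) mod 3"
  have "card {u\<in>markoff p. coord u j = 0} \<le> 2 * card {0..<p}"
  proof (rule card_le_fibers[where f = "\<lambda>u. coord u k"])
    fix c assume "c \<in> {0..<p}"
    let ?A = "{u\<in>{u\<in>markoff p. coord u j = 0}. coord u k = c}"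
    let ?R = "{t\<in>{0..<p}. p dvd poly [:c^2, 0, 1:] t}"
    have "card ?A \<le> card ?R"
    proof (rule card_inj_on_le[where f = "\<lambda>u. coord u l"])
      show "inj_on (\<lambda>u. coord u l) ?A"
      proof (rule inj_onI, rule coord_eqI)
        fix u v and i :: nat assume uv: "u \<in> ?A" "v \<in> ?A" "coord u l = coord v l" and i: "i < 3"
        have "i = j \<or> i = k \<or> i = l"
          using less_three_cases[OF j] less_three_cases[OF i] unfolding k_def l_def
          by (elim disjE; simp add: mod_Suc)
        then show "coord u i = coord v i"
          using uv by auto
      qed
      show "(\<lambda>u. coord u l) ` ?A \<subseteq> ?R"
      proof
        fix t assume "t \<in> (\<lambda>u. coord u l) ` ?A"
        then obtain u where u: "u \<in> ?A" "t = coord u l" by blast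
        have "[(coord u j)^2 + (coord u k)^2 + (coord u l)^2 = coord u j * coord u k * coord u l] (mod p)"
          using markoff_coord_cong[OF _ j] u(1) unfolding k_def l_def by blast
        then have "p dvd c^2 + t^2"
          using u by (auto simp: cong_iff_dvd_diff)
        moreover have "t \<in> {0..<p}"
          using u markoff_coord_range by blast
        ultimately show "t \<in> ?R"
          by (simp add: power2_eq_square algebra_simps)
      qed
    qed (rule finite_residues)
    also have "\<dots> \<le> degree [:c^2, 0, 1:]"
      using p by (intro card_roots_mod_prime) auto
    finally show "card ?A \<le> 2" by simp
  qed (use markoff_coord_range in auto)
  then show ?thesis by simp
qed

text \<open>Points with a zero coordinate number at most \<open>2 * p\<close> per coordinate, hence
  the 6; the others lie on at most \<open>p\<close> lines, each with at most
  \<open>3 * 2 ^ length w\<close> fixed points.\<close>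

theorem card_fixed_points:
  fixes p :: int
  assumes p: "prime p" and w: "w \<noteq> []" "set w \<subseteq> {..<3}" "distinct_adj w"
  shows "card {u\<in>markoff p. word_action p w u = u} \<le> (6 + 3 * 2 ^ length w) * nat p"
proof -
  obtain iz where iz: "\<And>z. \<not> p dvd z \<Longrightarrow> [z * iz z = 1] (mod p)"
    using inverse_mod_prime[OF p] by blast
  define par where "par = (\<lambda>i u. coord u i * iz (coord u 2) mod p)"
  define F where "F = {u\<in>markoff p. word_action p w u = u \<and> (\<forall>j<3. coord u j \<noteq> 0)}"
  \<comment> \<open>On a line where \<open>par (1 - i)\<close> is constant, coordinate
    \<open>i\<close> has degree 2, and the growth argument asks that it differ from the first
    letter.\<close>
  define i :: nat where "i = (if hd w = 0 then 1 else 0)"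
  have i: "i < 2" "distinct_adj (i # w)"
    unfolding i_def using w by (auto simp: distinct_adj_Cons)
  have prange: "par j u \<in> {0..<p}" for j u
    unfolding par_def using prime_gt_0_int[OF p] by simp
  have crange: "coord u j \<in> {0..<p}" if "u \<in> F" for u j
    using that markoff_coord_range unfolding F_def by blast
  have nd: "\<not> p dvd coord u j" if "u \<in> F" "j < 3" for u j
    using not_dvd_residue[OF markoff_coord_range[of u p j]] that unfolding F_def by blast
  have chart: "[coord u 0 = par 0 u * coord u 2] (mod p)" "[coord u 1 = par 1 u * coord u 2] (mod p)"
    "[par 1 u * coord u 0 = (par 0 u)^2 + (par 1 u)^2 + 1] (mod p)"
    "[par 0 u * coord u 1 = (par 0 u)^2 + (par 1 u)^2 + 1] (mod p)"
    "[par 0 u * par 1 u * coord u 2 = (par 0 u)^2 + (par 1 u)^2 + 1] (mod p)" if "u \<in> F" for u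
  proof -
    have "[(coord u 0)^2 + (coord u 1)^2 + (coord u 2)^2 = coord u 0 * coord u 1 * coord u 2] (mod p)"
      using markoff_coord_cong[of u p 0] that unfolding F_def by (simp add: numeral_2_eq_2)
    from chart_equations[OF this iz[OF nd[OF that]]]
    show "[coord u 0 = par 0 u * coord u 2] (mod p)" "[coord u 1 = par 1 u * coord u 2] (mod p)"
    "[par 1 u * coord u 0 = (par 0 u)^2 + (par 1 u)^2 + 1] (mod p)"
    "[par 0 u * coord u 1 = (par 0 u)^2 + (par 1 u)^2 + 1] (mod p)"
    "[par 0 u * par 1 u * coord u 2 = (par 0 u)^2 + (par 1 u)^2 + 1] (mod p)"
      unfolding par_def by simp_all
  qed
  have ndpar: "\<not> p dvd par j u" if "u \<in> F" "j < 2" for j u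
  proof
    assume "p dvd par j u"
    moreover have "j = 0 \<or> j = 1"
      using that(2) by auto
    then have "[coord u j = par j u * coord u 2] (mod p)"
      using chart(1,2)[OF that(1)] by blast
    ultimately have "p dvd coord u j"
      by (metis cong_dvd_iff dvd_mult2)
    then show False
      using nd[OF that(1)] that(2) by simp
  qed
  \<comment> \<open>As \<open>par 0 u * par 1 u\<close> is invertible, the last chart equation
    determines \<open>coord u 2\<close>, and the first two then determine the other
    coordinates.\<close>
  have inj: "u = v" if uv: "u \<in> F" "v \<in> F" "par 0 u = par 0 v" "par 1 u = par 1 v" for u v
  proof -
    have "[par 0 u * par 1 u * coord u 2 = par 0 u * par 1 u * coord v 2] (mod p)"
      using chart(5)[OF uv(1)] chart(5)[OF uv(2)] uv(3,4) by (metis cong_sym cong_trans)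
    moreover have "coprime (par 0 u * par 1 u) p"
      using ndpar[OF uv(1)] p by (metis coprime_commute coprime_mult_left_iff one_less_numeral_iff
        prime_imp_coprime semiring_norm(76) zero_less_numeral)
    ultimately have "[coord u 2 = coord v 2] (mod p)"
      by (simp add: cong_mult_lcancel)
    then have z: "coord u 2 = coord v 2"
      using crange[OF uv(1)] crange[OF uv(2)] by (rule cong_range_eq)
    have "[coord u 0 = coord v 0] (mod p)" "[coord u 1 = coord v 1] (mod p)"
      using chart(1,2)[OF uv(1)] chart(1,2)[OF uv(2)] uv(3,4) z by (metis cong_sym cong_trans)+
    then have "coord u 0 = coord v 0" "coord u 1 = coord v 1"
      using cong_range_eq crange[OF uv(1)] crange[OF uv(2)] by blast+
    then show ?thesis
      using z less_three_cases by (intro coord_eqI) force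
  qed
  have "card F \<le> (3 * 2 ^ length w) * card {0..<p}"
  proof (rule card_le_fibers[where f = "par (1 - i)"])
    fix c assume "c \<in> {0..<p}"
    let ?A = "{u\<in>F. par (1 - i) u = c}"
    let ?R = "{t\<in>{0..<p}. \<exists>u. word_action p w u = u
      \<and> [c*t*coord u i = t*(t^2+c^2+1)] (mod p)
      \<and> [c*t*coord u (1-i) = c*(t^2+c^2+1)] (mod p)
      \<and> [c*t*coord u 2 = t^2+c^2+1] (mod p)}"
    show "card ?A \<le> 3 * 2 ^ length w"
    proof (cases "p dvd c")
      case True
      then have "?A = {}"
        using ndpar[of _ "1 - i"] by auto
      then show ?thesis by (metis card.empty le0)
    next
      case False
      have i01: "i = 0 \<or> i = 1"
        using i by auto
      have "card ?A \<le> card ?R"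
      proof (rule card_inj_on_le[where f = "par i"])
        show "inj_on (par i) ?A"
          using inj i01 by (intro inj_onI) auto
        show "par i ` ?A \<subseteq> ?R"
        proof
          fix t assume "t \<in> par i ` ?A"
          then obtain u where u: "u \<in> F" "par (1 - i) u = c" "t = par i u" by blast
          have A: "[c * coord u i = t^2+c^2+1] (mod p)" "[t * coord u (1-i) = t^2+c^2+1] (mod p)"
            "[c*t*coord u 2 = t^2+c^2+1] (mod p)"
            using chart(3-5)[OF u(1)] i01 u(2,3) by (auto simp: ac_simps)
          have "[t * (c * coord u i) = t * (t^2+c^2+1)] (mod p)"
            "[c * (t * coord u (1-i)) = c * (t^2+c^2+1)] (mod p)"
            by (intro cong_mult cong_refl A)+
          then have "[c*t*coord u i = t*(t^2+c^2+1)] (mod p)" "[c*t*coord u (1-i) = c*(t^2+c^2+1)] (mod p)"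
            by (simp_all only: ac_simps)
          then show "t \<in> ?R"
            using A(3) u prange unfolding F_def by blast
        qed
      qed (rule finite_residues)
      also have "\<dots> \<le> 3 * 2 ^ length w"
        by (rule fixed_points_on_line[OF p False i(1) w(1,2) i(2)])
      finally show ?thesis .
    qed
  qed (use prange in auto)
  then have cF: "card F \<le> (3 * 2 ^ length w) * nat p"
    by simp
  let ?Z = "\<lambda>j. {u\<in>markoff p. coord u j = 0}"
  have "{u\<in>markoff p. word_action p w u = u} \<subseteq> F \<union> (\<Union>j\<in>{..<3}. ?Z j)"
    unfolding F_def by auto
  then have "card {u\<in>markoff p. word_action p w u = u} \<le> card (F \<union> (\<Union>j\<in>{..<3}. ?Z j))"
    using finite_markoff[of p] by (intro card_mono) (auto simp: F_def)
  also have "\<dots> \<le> card F + card (\<Union>j\<in>{..<3}. ?Z j)"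
    by (rule card_Un_le)
  also have "card (\<Union>j\<in>{..<3}. ?Z j) \<le> (\<Sum>j<3. card (?Z j))"
    by (rule card_UN_le) simp
  also have "\<dots> \<le> (\<Sum>j<(3::nat). 2 * nat p)"
    by (intro sum_mono card_zero_coord[OF p]) simp
  finally show ?thesis
    using cF by (simp add: algebra_simps)
qed

text \<open>\<open>psi\<close> inverts the chart. For each of the \<open>p - 1\<close> nonzero
  residues \<open>b\<close>, at least \<open>p - 3\<close> nonzero \<open>a\<close> avoid the at
  most two roots of \<open>t^2+b^2+1\<close>.\<close>

theorem card_markoff_lower:
  fixes p :: int
  assumes p: "prime p"
  shows "(p - 1) * (p - 3) \<le> int (card (markoff p))"
proof -
  obtain iz where iz: "\<And>z. \<not> p dvd z \<Longrightarrow> [z * iz z = 1] (mod p)"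
    using inverse_mod_prime[OF p] by blast
  define R where "R = (\<lambda>b. {a\<in>{1..<p}. \<not> p dvd a^2+b^2+1})"
  have p1: "p > 1"
    using p by (rule prime_gt_1_int)
  have fin: "finite (R b)" for b
    unfolding R_def by (rule finite_subset[of _ "{1..<p}"]) auto
  have cR: "int (card (R b)) \<ge> p - 3" for b
  proof -
    let ?B = "{t\<in>{0..<p}. p dvd poly [:b^2+1, 0, 1:] t}"
    have "card ?B \<le> degree [:b^2+1, 0, 1:]"
      using p by (intro card_roots_mod_prime) auto
    moreover have "card {1..<p} \<le> card (R b \<union> ?B)"
      by (intro card_mono finite_UnI finite_residues fin) (auto simp: R_def power2_eq_square algebra_simps)
    then have "card {1..<p} \<le> card (R b) + card ?B"
      using card_Un_le le_trans by blast
    ultimately have "card {1..<p} \<le> card (R b) + 2"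
      by simp
    then show ?thesis
      by simp
  qed
  define psi where "psi = (\<lambda>(b,a). (((a^2+b^2+1) * iz b) mod p, ((a^2+b^2+1) * iz a) mod p,
     ((a^2+b^2+1) * iz a * iz b) mod p))"
  have main: "psi (b,a) \<in> markoff p \<and> \<not> p dvd coord (psi (b,a)) 2
     \<and> [a * coord (psi (b,a)) 2 = coord (psi (b,a)) 0] (mod p)
     \<and> [b * coord (psi (b,a)) 2 = coord (psi (b,a)) 1] (mod p)"
    if b: "b \<in> {1..<p}" and a: "a \<in> R b" for a b
  proof -
    define S where "S = a^2+b^2+1"
    have nS: "\<not> p dvd S" and a1: "a \<in> {1..<p}"
      using a unfolding R_def S_def by auto
    have "\<not> p dvd a" "\<not> p dvd b"
      using a1 b not_dvd_residue[of a p] not_dvd_residue[of b p] by auto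
    then have ia: "[a * iz a = 1] (mod p)" and ib: "[b * iz b = 1] (mod p)"
      using iz by auto
    define x y z where "x = S * iz b" and "y = S * iz a" and "z = S * iz a * iz b"
    have "[a * z = S * iz b * (a * iz a)] (mod p)" unfolding z_def by (simp add: ac_simps)
    also have "[S * iz b * (a * iz a) = S * iz b * 1] (mod p)"
      by (intro cong_mult cong_refl ia)
    finally have ax: "[a * z = x] (mod p)" by (simp add: x_def)
    have "[b * z = S * iz a * (b * iz b)] (mod p)" unfolding z_def by (simp add: ac_simps)
    also have "[S * iz a * (b * iz b) = S * iz a * 1] (mod p)"
      by (intro cong_mult cong_refl ib)
    finally have bz: "[b * z = y] (mod p)" by (simp add: y_def)
    have "[a * y = S * (a * iz a)] (mod p)" unfolding y_def by (simp add: ac_simps)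
    also have "[S * (a * iz a) = S * 1] (mod p)"
      by (intro cong_mult cong_refl ia)
    finally have ay: "[a * y = S] (mod p)" by simp
    have "[x^2 + y^2 + z^2 = (a*z)^2 + (b*z)^2 + z^2] (mod p)"
      by (intro cong_add cong_pow cong_refl cong_sym[OF ax] cong_sym[OF bz])
    also have "(a*z)^2 + (b*z)^2 + z^2 = z * z * S"
      unfolding S_def by (simp add: algebra_simps power2_eq_square)
    also have "[z * z * S = z * z * (a * y)] (mod p)"
      by (intro cong_mult cong_refl cong_sym[OF ay])
    also have "z * z * (a * y) = (a * z) * y * z"
      by simp
    also have "[(a * z) * y * z = x * y * z] (mod p)"
      by (intro cong_mult cong_refl ax)
    finally have eq: "[x^2 + y^2 + z^2 = x * y * z] (mod p)" .
    \<comment> \<open>As \<open>a*b*z\<close> is congruent to \<open>S\<close>, divisibility of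
      \<open>z\<close> would carry over to \<open>S\<close>. This also keeps the image away from the
      origin.\<close>
    have nz: "\<not> p dvd z"
    proof
      assume "p dvd z"
      then have "p dvd a * (b * z)" by simp
      moreover have "[a * (b * z) = a * y] (mod p)"
        by (intro cong_mult cong_refl bz)
      then have "[a * (b * z) = S] (mod p)"
        using ay cong_trans by blast
      ultimately show False
        using nS by (metis cong_dvd_iff)
    qed
    have psi: "psi (b,a) = (x mod p, y mod p, z mod p)"
      unfolding psi_def x_def y_def z_def S_def by simp
    have "z mod p \<noteq> 0"
      using nz by (simp add: dvd_eq_mod_eq_0)
    moreover have "[(x mod p)^2 + (y mod p)^2 + (z mod p)^2 = (x mod p) * (y mod p) * (z mod p)] (mod p)"
    proof -
      have m: "[t mod p = t] (mod p)" for t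
        by (simp add: cong_def)
      have "[(x mod p)^2 + (y mod p)^2 + (z mod p)^2 = x^2 + y^2 + z^2] (mod p)"
        by (intro cong_add cong_pow m)
      moreover have "[x * y * z = (x mod p) * (y mod p) * (z mod p)] (mod p)"
        by (intro cong_mult cong_sym[OF m])
      ultimately show ?thesis
        using eq cong_trans by blast
    qed
    ultimately have "psi (b,a) \<in> markoff p"
      unfolding psi markoff_def using p1 by (simp add: cong_def)
    moreover have "\<not> p dvd coord (psi (b,a)) 2"
      unfolding psi using nz by (simp add: dvd_mod_iff)
    moreover have "[a * coord (psi (b,a)) 2 = coord (psi (b,a)) 0] (mod p)"
      "[b * coord (psi (b,a)) 2 = coord (psi (b,a)) 1] (mod p)"
      unfolding psi using ax bz by (simp_all add: cong_def mod_simps)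
    ultimately show ?thesis by blast
  qed
  \<comment> \<open>The parameters are recovered as \<open>x/z\<close> and \<open>y/z\<close>, since
    \<open>z\<close> is invertible.\<close>
  have "inj_on psi (Sigma {1..<p} R)"
  proof (rule inj_onI)
    fix s t assume st: "s \<in> Sigma {1..<p} R" "t \<in> Sigma {1..<p} R" "psi s = psi t"
    obtain b a b' a' where [simp]: "s = (b,a)" "t = (b',a')"
      by (cases s, cases t)
    have r: "a \<in> {0..<p}" "a' \<in> {0..<p}" "b \<in> {0..<p}" "b' \<in> {0..<p}"
      using st unfolding R_def by auto
    have m: "psi (b,a) = psi (b',a')" "b \<in> {1..<p}" "a \<in> R b" "b' \<in> {1..<p}" "a' \<in> R b'"
      using st by auto
    note M = main[OF m(2,3)] and M' = main[OF m(4,5), folded m(1)]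
    have cop: "coprime (coord (psi (b,a)) 2) p"
      using M p by (metis coprime_commute prime_imp_coprime)
    have "[a * coord (psi (b,a)) 2 = a' * coord (psi (b,a)) 2] (mod p)"
      "[b * coord (psi (b,a)) 2 = b' * coord (psi (b,a)) 2] (mod p)"
      using M M' by (metis cong_sym cong_trans)+
    then have "[a = a'] (mod p)" "[b = b'] (mod p)"
      using cop by (simp_all add: cong_mult_rcancel)
    then show "s = t"
      using cong_range_eq r by auto
  qed
  then have "card (Sigma {1..<p} R) \<le> card (markoff p)"
    using main finite_markoff by (intro card_inj_on_le[of psi]) auto
  moreover have "int (card (Sigma {1..<p} R)) = (\<Sum>b\<in>{1..<p}. int (card (R b)))"
    using fin by simp
  moreover have "(\<Sum>b\<in>{1..<p}. int (card (R b))) \<ge> (\<Sum>b\<in>{1..<p}. p - 3)"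
    by (intro sum_mono cR)
  ultimately show ?thesis
    using p1 by simp
qed

section \<open>Traces and reduced words\<close>

text \<open>On the 3-regular tree, \<^term>\<open>km_poly k\<close> of the adjacency operator is the operator
  of non-backtracking walks of length \<^term>\<open>k\<close>.\<close>

fun km_poly :: "nat \<Rightarrow> real poly" where
  "km_poly 0 = 1"
| "km_poly (Suc 0) = [:0, 1:]"
| "km_poly (Suc (Suc 0)) = [:-3, 0, 1:]"
| "km_poly (Suc (Suc (Suc k))) = [:0, 1:] * km_poly (Suc (Suc k)) - [:2:] * km_poly (Suc k)"

definition reduced :: "nat \<Rightarrow> nat list set" where
  "reduced k = {w. set w \<subseteq> {..<3} \<and> length w = k \<and> distinct_adj w}"

text \<open>The adjacency matrix as an operator on functions of triples, free of the enumeration of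
  the vertices. It is defined off the surface too, where the moves need not be involutions.\<close>

definition adj_op :: "int \<Rightarrow> (int \<times> int \<times> int \<Rightarrow> real) \<Rightarrow> int \<times> int \<times> int \<Rightarrow> real" where
  "adj_op p g u = (\<Sum>i<3. g (markoff_move p i u))"

definition reduced_op :: "int \<Rightarrow> nat \<Rightarrow> (int \<times> int \<times> int \<Rightarrow> real) \<Rightarrow> int \<times> int \<times> int \<Rightarrow> real" where
  "reduced_op p k g u = (\<Sum>w\<in>reduced k. g (word_action p w u))"

lemma finite_reduced: "finite (reduced k)"
  by (rule finite_subset[OF _ finite_lists_length_eq[of "{..<3}" k]]) (auto simp: reduced_def)

lemma reduced_0: "reduced 0 = {[]}"
  by (auto simp: reduced_def)

lemma sum_reduced_Suc:
  "(\<Sum>w\<in>reduced (Suc k). h w) = (\<Sum>i<3. \<Sum>w\<in>{w\<in>reduced k. distinct_adj (i # w)}. h (i # w))"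
proof -
  have "(\<Sum>w\<in>reduced (Suc k). h w)
      = (\<Sum>(i,w)\<in>Sigma {..<3} (\<lambda>i. {w\<in>reduced k. distinct_adj (i # w)}). h (i # w))"
    by (rule sum.reindex_bij_witness[where j = "\<lambda>w. (hd w, tl w)" and i = "\<lambda>(i,w). i # w"])
       (auto simp: reduced_def length_Suc_conv dest: distinct_adj_ConsD)
  also have "\<dots> = (\<Sum>i<3. \<Sum>w\<in>{w\<in>reduced k. distinct_adj (i # w)}. h (i # w))"
    by (rule sum.Sigma[symmetric]) (auto simp: finite_reduced)
  finally show ?thesis .
qed

lemma adj_op_reduced_op_0: "adj_op p (reduced_op p 0 g) u = reduced_op p (Suc 0) g u"
proof -
  have "{w \<in> reduced 0. distinct_adj (i # w)} = {[]}" for i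
    unfolding reduced_0 by auto
  then show ?thesis
    unfolding reduced_op_def sum_reduced_Suc by (simp add: adj_op_def reduced_0 word_action_def)
qed

text \<open>A move \<open>i\<close> before a reduced word either lengthens it or cancels its first
  letter. A reduced word of length \<open>k\<close> is left by cancellation once for each letter
  other than its own first: twice, or three times if it is empty.\<close>

lemma adj_op_reduced_op_Suc:
  assumes u: "u \<in> markoff p"
  shows "adj_op p (reduced_op p (Suc k) g) u
    = reduced_op p (Suc (Suc k)) g u + (if k = 0 then 3 else 2) * reduced_op p k g u"
proof -
  let ?R = "\<lambda>i. {w\<in>reduced (Suc k). distinct_adj (i # w)}"
  let ?S = "\<lambda>i. {w\<in>reduced k. distinct_adj (i # w)}"
  have split: "reduced_op p (Suc k) g (markoff_move p i u)
      = (\<Sum>w\<in>?R i. g (word_action p (i # w) u)) + (\<Sum>w\<in>?S i. g (word_action p w u))" if i: "i < 3" for i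
  proof -
    have "reduced (Suc k) = ?R i \<union> (#) i ` ?S i"
      using i by (auto simp: reduced_def length_Suc_conv distinct_adj_Cons)
    moreover have "?R i \<inter> (#) i ` ?S i = {}"
      by auto
    moreover have "finite (?R i)" "finite ((#) i ` ?S i)"
      using finite_reduced by auto
    ultimately have "reduced_op p (Suc k) g (markoff_move p i u)
      = (\<Sum>w\<in>?R i. g (word_action p w (markoff_move p i u))) + (\<Sum>w\<in>(#) i ` ?S i. g (word_action p w (markoff_move p i u)))"
      unfolding reduced_op_def by (metis (no_types, lifting) sum.union_disjoint)
    moreover have "(\<Sum>w\<in>(#) i ` ?S i. g (word_action p w (markoff_move p i u))) = (\<Sum>w\<in>?S i. g (word_action p w u))"
      using markoff_move_closed[OF u i] by (subst sum.reindex) (auto simp: word_action_def inj_on_def)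
    ultimately show ?thesis
      by (simp add: word_action_def)
  qed
  have count: "card {i\<in>{..<3}. distinct_adj (i # w)} = (if k = 0 then 3 else 2)" if w: "w \<in> reduced k" for w
  proof (cases w)
    case Nil
    then show ?thesis using w by (simp add: reduced_def)
  next
    case (Cons a v)
    then have "{i\<in>{..<3}. distinct_adj (i # w)} = {..<3} - {a}"
      using w by (auto simp: reduced_def)
    moreover have "a \<in> {..<3}" "k \<noteq> 0"
      using w Cons by (auto simp: reduced_def)
    ultimately show ?thesis by simp
  qed
  have "(\<Sum>i<3. \<Sum>w\<in>?S i. g (word_action p w u))
      = (\<Sum>w\<in>reduced k. \<Sum>i\<in>{i\<in>{..<3}. distinct_adj (i # w)}. g (word_action p w u))"
    by (rule sum.swap_restrict) (auto simp: finite_reduced)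
  also have "\<dots> = (\<Sum>w\<in>reduced k. (if k = 0 then 3 else 2) * g (word_action p w u))"
    using count by (intro sum.cong) simp_all
  finally have backtrack: "(\<Sum>i<3. \<Sum>w\<in>?S i. g (word_action p w u)) = (if k = 0 then 3 else 2) * reduced_op p k g u"
    unfolding reduced_op_def by (simp add: sum_distrib_left)
  have "adj_op p (reduced_op p (Suc k) g) u
      = (\<Sum>i<3. \<Sum>w\<in>?R i. g (word_action p (i # w) u)) + (\<Sum>i<3. \<Sum>w\<in>?S i. g (word_action p w u))"
    unfolding adj_op_def by (simp add: split sum.distrib)
  then show ?thesis
    unfolding backtrack unfolding reduced_op_def sum_reduced_Suc[of _ "Suc k"] .
qed

lemma adj_op_pow_Suc: "(adj_op p ^^ Suc j) g u = (\<Sum>i<3. (adj_op p ^^ j) g (markoff_move p i u))"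
  by (subst adj_op_def[symmetric]) simp

lemma adj_op_pow_linear:
  "(adj_op p ^^ j) (\<lambda>u. g u + c * h u) = (\<lambda>u. (adj_op p ^^ j) g u + c * (adj_op p ^^ j) h u)"
proof (induction j)
  case (Suc j)
  show ?case
    by (rule ext) (simp only: adj_op_pow_Suc Suc sum.distrib sum_distrib_left)
qed simp

text \<open>The recurrence above is available only on the surface; as the moves preserve the
  surface, values elsewhere never enter.\<close>

lemma adj_op_pow_cong:
  assumes "\<And>u. u \<in> markoff p \<Longrightarrow> g u = h u"
  shows "u \<in> markoff p \<Longrightarrow> (adj_op p ^^ j) g u = (adj_op p ^^ j) h u"
proof (induction j arbitrary: u)
  case (Suc j)
  show ?case
    unfolding adj_op_pow_Suc using Suc markoff_move_closed by (intro sum.cong refl) auto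
qed (simp add: assms)

lemma adj_op_pow_reduced_op:
  assumes u: "u \<in> markoff p"
  shows "(adj_op p ^^ Suc j) (reduced_op p (Suc k) g) u
    = (adj_op p ^^ j) (reduced_op p (Suc (Suc k)) g) u
      + (if k = 0 then 3 else 2) * (adj_op p ^^ j) (reduced_op p k g) u"
proof -
  have "(adj_op p ^^ Suc j) (reduced_op p (Suc k) g) u
      = (adj_op p ^^ j) (adj_op p (reduced_op p (Suc k) g)) u"
    by (simp add: funpow_swap1)
  also have "\<dots> = (adj_op p ^^ j)
      (\<lambda>u. reduced_op p (Suc (Suc k)) g u + (if k = 0 then 3 else 2) * reduced_op p k g u) u"
    by (rule adj_op_pow_cong[OF adj_op_reduced_op_Suc u])
  finally show ?thesis
    unfolding adj_op_pow_linear .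
qed

section \<open>From functions on the surface to the adjacency matrix\<close>

lemma markoff_verts: "distinct (markoff_verts p)" "set (markoff_verts p) = markoff p"
proof -
  have "\<exists>vs. distinct vs \<and> set vs = markoff p"
    using finite_distinct_list[OF finite_markoff[of p]] by blast
  from someI_ex[OF this] show "distinct (markoff_verts p)" "set (markoff_verts p) = markoff p"
    unfolding markoff_verts_def by blast+
qed

lemma sum_markoff_verts:
  "(\<Sum>l<length (markoff_verts p). h (markoff_verts p ! l)) = (\<Sum>v\<in>markoff p. h v)"
  using sum.reindex_bij_betw[OF bij_betw_nth[OF markoff_verts(1) refl markoff_verts(2)[symmetric]], of h] .

lemma markoff_verts_nth: "i < length (markoff_verts p) \<Longrightarrow> markoff_verts p ! i \<in> markoff p"
  using markoff_verts(2) nth_mem by blast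

lemma markoff_adj_carrier:
  "markoff_adj p \<in> carrier_mat (length (markoff_verts p)) (length (markoff_verts p))"
  by (simp add: markoff_adj_def perm_matrix_def Let_def)

lemma markoff_adj_entry:
  assumes "i < length (markoff_verts p)" "j < length (markoff_verts p)"
  shows "markoff_adj p $$ (i,j) = (\<Sum>l<3. if markoff_move p l (markoff_verts p ! i) = markoff_verts p ! j then 1 else 0)"
  using assms by (simp add: markoff_adj_def perm_matrix_def Let_def eval_nat_numeral markoff_move_def)

text \<open>Each move undoes itself, so every edge can be traversed both ways by the same
  letter.\<close>

lemma markoff_adj_symmetric: "transpose_mat (markoff_adj p) = markoff_adj p"
proof -
  have "markoff_move p l v = u \<longleftrightarrow> markoff_move p l u = v" if "u \<in> markoff p" "v \<in> markoff p" "l < 3" for u v l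
    using markoff_move_closed that by metis
  then show ?thesis
    using markoff_adj_carrier[of p] markoff_verts_nth
    by (intro eq_matI) (auto simp: markoff_adj_entry intro!: sum.cong)
qed

lemma pow_mat_Suc_left:
  assumes "A \<in> carrier_mat n n"
  shows "A ^\<^sub>m Suc k = A * A ^\<^sub>m k"
proof (induction k)
  case 0
  then show ?case using assms by simp
next
  case (Suc k)
  have "A ^\<^sub>m Suc (Suc k) = (A * A ^\<^sub>m k) * A"
    using Suc by simp
  also have "\<dots> = A * (A ^\<^sub>m k * A)"
    using assms by (intro assoc_mult_mat[of _ n n _ n _ n]) simp_all
  finally show ?case by simp
qed

lemma markoff_adj_pow_entry:
  assumes "i < length (markoff_verts p)" "j < length (markoff_verts p)"
  shows "(markoff_adj p ^\<^sub>m k) $$ (i,j)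
    = (adj_op p ^^ k) (\<lambda>u. if u = markoff_verts p ! j then 1 else 0) (markoff_verts p ! i)"
  using assms
proof (induction k arbitrary: i)
  case 0
  then show ?case
    using markoff_adj_carrier[of p] nth_eq_iff_index_eq[OF markoff_verts(1)] by auto
next
  case (Suc k)
  let ?n = "length (markoff_verts p)" and ?v = "\<lambda>i. markoff_verts p ! i"
  let ?F = "(adj_op p ^^ k) (\<lambda>u. if u = ?v j then 1 else 0)"
  note C = markoff_adj_carrier[of p]
  have "(markoff_adj p ^\<^sub>m Suc k) $$ (i,j) = (\<Sum>l<?n. markoff_adj p $$ (i,l) * (markoff_adj p ^\<^sub>m k) $$ (l,j))"
    unfolding pow_mat_Suc_left[OF C] using C pow_carrier_mat[OF C, of k] Suc.prems
    by (simp add: scalar_prod_def atLeast0LessThan)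
  also have "\<dots> = (\<Sum>l<?n. (\<Sum>m<3. if markoff_move p m (?v i) = ?v l then 1 else 0) * ?F (?v l))"
    using Suc by (intro sum.cong) (simp_all add: markoff_adj_entry)
  also have "\<dots> = (\<Sum>v\<in>markoff p. (\<Sum>m<3. if markoff_move p m (?v i) = v then 1 else 0) * ?F v)"
    by (rule sum_markoff_verts)
  also have "\<dots> = (\<Sum>m<3. \<Sum>v\<in>markoff p. if markoff_move p m (?v i) = v then ?F v else 0)"
    unfolding sum_distrib_right by (subst sum.swap) (intro sum.cong refl, simp)
  also have "\<dots> = (\<Sum>m<3. ?F (markoff_move p m (?v i)))"
    using markoff_move_closed[OF markoff_verts_nth[OF Suc.prems(1)]] finite_markoff[of p]
    by (intro sum.cong refl) simp
  finally show ?case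
    unfolding adj_op_pow_Suc .
qed

lemma eig_sum_poly_linear:
  "eig_sum A (poly (f + g)) = eig_sum A (poly f) + eig_sum A (poly g)"
  "eig_sum A (poly (f - g)) = eig_sum A (poly f) - eig_sum A (poly g)"
  "eig_sum A (poly (Polynomial.smult c f)) = c * eig_sum A (poly f)"
  by (simp_all add: eig_sum_def algebra_simps sum.distrib sum_subtractf sum_distrib_left)

text \<open>The recurrence of \<open>km_poly\<close> multiplies by the variable, which leads out of
  the family. The power \<open>j\<close> absorbs this factor: indices \<open>k\<close> shrink at the
  cost of larger \<open>j\<close>, down to traces of plain powers, and \<open>adj_op\<close> obeys
  the same recurrence on words.\<close>

lemma eig_sum_monom_km:
  "eig_sum (markoff_adj p) (poly (Polynomial.monom 1 j * km_poly k))
     = (\<Sum>u\<in>markoff p. (adj_op p ^^ j) (reduced_op p k (\<lambda>v. if v = u then 1 else 0)) u)"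
proof (induction k arbitrary: j rule: less_induct)
  case (less k)
  let ?E = "\<lambda>f. eig_sum (markoff_adj p) (poly f)"
  let ?T = "\<lambda>j k. \<Sum>u\<in>markoff p. (adj_op p ^^ j) (reduced_op p k (\<lambda>v. if v = u then 1 else 0)) u"
  consider "k = 0" | "k = Suc 0" | m where "k = Suc (Suc m)"
    by (metis not0_implies_Suc)
  then show ?case
  proof cases
    case 1
    have "reduced_op p 0 g = g" for g
      by (rule ext) (simp add: reduced_op_def reduced_0 word_action_def)
    moreover have "poly (Polynomial.monom 1 j * km_poly 0) = (\<lambda>t. t ^ j)"
      by (rule ext) (simp add: poly_monom)
    ultimately show ?thesis
      unfolding 1 using eig_sum_power[OF markoff_adj_carrier markoff_adj_symmetric, of p j]
        markoff_adj_pow_entry[of _ p _ j]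
        sum_markoff_verts[of "\<lambda>v. (adj_op p ^^ j) (\<lambda>u. if u = v then 1 else 0) v" p] by simp
  next
    case 2
    have "Polynomial.monom 1 j * km_poly k = Polynomial.monom 1 (Suc j) * km_poly 0"
      unfolding 2 by (simp add: monom_Suc)
    moreover have "adj_op p (reduced_op p 0 g) = reduced_op p (Suc 0) g" for g
      by (rule ext) (rule adj_op_reduced_op_0)
    ultimately show ?thesis
      using less(1)[of 0 "Suc j"] unfolding 2 by (simp add: funpow_swap1)
  next
    case (3 m)
    let ?c = "if m = 0 then 3 else 2 :: real"
    have "km_poly k = [:0, 1:] * km_poly (Suc m) - Polynomial.smult ?c (km_poly m)"
      unfolding 3 by (cases m) simp_all
    moreover have "Polynomial.monom (1 :: real) (Suc j) = Polynomial.monom 1 j * [:0, 1:]"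
      by (simp add: monom_Suc)
    ultimately have "Polynomial.monom 1 j * km_poly k
        = Polynomial.monom 1 (Suc j) * km_poly (Suc m) - Polynomial.smult ?c (Polynomial.monom 1 j * km_poly m)"
      by (simp only: right_diff_distrib mult.assoc mult_smult_right)
    then have "?E (Polynomial.monom 1 j * km_poly k) = ?T (Suc j) (Suc m) - ?c * ?T j m"
      using less(1)[of "Suc m" "Suc j"] less(1)[of m j] unfolding 3 by (simp only: eig_sum_poly_linear)
    also have "?T (Suc j) (Suc m) = ?T j k + ?c * ?T j m"
      unfolding 3 sum_distrib_left sum.distrib[symmetric]
      by (intro sum.cong refl adj_op_pow_reduced_op)
    finally show ?thesis
      by simp
  qed
qed

text \<open>For \<open>j = 0\<close> the summand at \<open>u\<close> counts the reduced words fixing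
  \<open>u\<close>; exchanging the sums counts fixed points word by word.\<close>

theorem eig_sum_km:
  "eig_sum (markoff_adj p) (poly (km_poly k)) = (\<Sum>w\<in>reduced k. real (card {u\<in>markoff p. word_action p w u = u}))"
proof -
  have "eig_sum (markoff_adj p) (poly (km_poly k))
      = (\<Sum>u\<in>markoff p. \<Sum>w\<in>reduced k. if word_action p w u = u then 1 else 0)"
    using eig_sum_monom_km[of p 0 k] by (simp add: reduced_op_def)
  also have "\<dots> = (\<Sum>w\<in>reduced k. \<Sum>u\<in>markoff p. if word_action p w u = u then 1 else 0)"
    by (rule sum.swap)
  also have "\<dots> = (\<Sum>w\<in>reduced k. real (card {u\<in>markoff p. word_action p w u = u}))"
    using finite_markoff[of p] by (simp add: sum.If_cases Collect_conj_eq)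
  finally show ?thesis .
qed

section \<open>Moments of the Kesten--McKay density\<close>

lemma two_cos_sin: "2 * cos t * sin (real (Suc n) * t) = sin (real (Suc (Suc n)) * t) + sin (real n * t)"
proof -
  have "sin (real (Suc (Suc n)) * t) = sin (real (Suc n) * t + t)" "sin (real n * t) = sin (real (Suc n) * t - t)"
    by (simp_all add: algebra_simps)
  then show ?thesis
    unfolding sin_add sin_diff by simp
qed

text \<open>At \<open>2 * sqrt 2 * cos t\<close> these are combinations of Chebyshev polynomials of
  the second kind, which become sines after multiplication by \<open>sin t\<close>; the recurrence
  turns into \<open>two_cos_sin\<close>.\<close>

lemma km_trig:
  "poly (km_poly (Suc k)) (2 * sqrt 2 * cos t) * sin t
    = sqrt 2 ^ Suc k * (sin (real (k + 2) * t) - sin (real k * t) / 2)"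
proof (induction k rule: less_induct)
  case (less k)
  consider "k = 0" | "k = 1" | m where "k = Suc (Suc m)"
    by (metis One_nat_def not0_implies_Suc)
  then show ?case
  proof cases
    case 1
    then show ?thesis by (simp add: sin_double)
  next
    case 2
    have s2: "sin (2 * t) = 2 * cos t * sin t"
      by (simp add: sin_double)
    have "sin (3 * t) = 2 * cos t * sin (2 * t) - sin t"
      using two_cos_sin[of t 1] by simp
    then have "sin (3 * t) = 4 * (cos t)^2 * sin t - sin t"
      unfolding s2 by (simp add: power2_eq_square)
    then show ?thesis
      unfolding 2 by (simp add: algebra_simps power2_eq_square)
  next
    case (3 m)
    let ?x = "2 * sqrt 2 * cos t" and ?r = "sqrt 2 ^ Suc m"
    let ?s = "\<lambda>n. sin (real n * t)"
    have I1: "poly (km_poly (Suc (Suc m))) ?x * sin t = (?r * sqrt 2) * (?s (m + 3) - ?s (m + 1) / 2)"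
      using less[of "Suc m"] 3 by (simp add: algebra_simps eval_nat_numeral)
    have I0: "poly (km_poly (Suc m)) ?x * sin t = ?r * (?s (m + 2) - ?s m / 2)"
      using less[of m] 3 by simp
    have c1: "2 * cos t * ?s (m + 3) = ?s (m + 4) + ?s (m + 2)"
      using two_cos_sin[of t "m + 2"] by (simp add: eval_nat_numeral)
    have c2: "2 * cos t * ?s (m + 1) = ?s (m + 2) + ?s m"
      using two_cos_sin[of t m] by simp
    \<comment> \<open>The only property of \<open>sqrt 2\<close> that enters is
      \<open>q * q = 2\<close>.\<close>
    have gen: "2 * q * C * (r * q * (A - B / 2)) - 2 * (r * (D - E / 2))
        = 2 * r * (2 * C * A - 2 * C * B / 2 - (D - E / 2))" if "q * q = 2" for q C r A B D E :: real
    proof -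
      have "2 * q * C * (r * q * (A - B / 2)) = (q * q) * (2 * C * r * (A - B / 2))"
        by (simp only: ac_simps)
      then show ?thesis
        unfolding that by (simp add: algebra_simps)
    qed
    have "poly (km_poly (Suc k)) ?x * sin t
        = ?x * (poly (km_poly (Suc (Suc m))) ?x * sin t) - 2 * (poly (km_poly (Suc m)) ?x * sin t)"
      unfolding 3 by (simp add: algebra_simps)
    also have "\<dots> = 2 * ?r * ((2 * cos t * ?s (m + 3)) - (2 * cos t * ?s (m + 1)) / 2
         - (?s (m + 2) - ?s m / 2))"
      unfolding I1 I0
    proof (rule gen)
      show "sqrt 2 * sqrt 2 = (2 :: real)" by simp
    qed
    also have "\<dots> = 2 * ?r * (?s (m + 4) - ?s (m + 2) / 2)"
      unfolding c1 c2 by (simp add: field_simps)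
    also have "2 * ?r = sqrt 2 ^ Suc k"
      unfolding 3 by simp
    finally show ?thesis
      unfolding 3 by (simp add: eval_nat_numeral)
  qed
qed

text \<open>The integrals arise from the density by the substitution
  \<open>2 * sqrt 2 * cos t\<close>. The denominator equals \<open>5 - 4 * cos (2*t)\<close>, up to
  a factor that of the Poisson kernel of radius 1/2 at the angle \<open>2*t\<close>.\<close>

definition poisson_integral :: "nat \<Rightarrow> real" where
  "poisson_integral n = integral {0..pi} (\<lambda>t. sin (real n * t) * sin t / (9 - 8 * (cos t)^2))"

lemma poisson_denominator: "9 - 8 * (cos t)^2 \<ge> (1 :: real)"
  using cos_squared_eq[of t] by simp

lemma poisson_integrable:
  "(\<lambda>t. sin (real n * t) * sin t / (9 - 8 * (cos t)^2)) integrable_on {0..pi}"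
proof -
  have "9 - 8 * (cos t)^2 \<noteq> (0::real)" for t
    using poisson_denominator[of t] by linarith
  then show ?thesis
    by (intro integrable_continuous_real continuous_intros) auto
qed

lemma poisson_integral_bound: "\<bar>poisson_integral n\<bar> \<le> pi"
proof -
  have "norm (poisson_integral n) \<le> integral {0..pi} (\<lambda>_. 1)"
    unfolding poisson_integral_def
  proof (rule integral_norm_bound_integral)
    fix t :: real
    have "\<bar>sin (real n * t) * sin t\<bar> \<le> 1"
      unfolding abs_mult by (intro mult_le_one) auto
    also have "1 \<le> \<bar>9 - 8 * (cos t)^2\<bar>"
      using poisson_denominator[of t] by linarith
    finally show "norm (sin (real n * t) * sin t / (9 - 8 * (cos t)^2)) \<le> 1"
      using poisson_denominator[of t] by (simp add: abs_divide divide_le_eq_1)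
  qed (use poisson_integrable in auto)
  then show ?thesis by simp
qed

lemma sin_product_integral:
  "((\<lambda>t. sin (real (n + 2) * t) * sin t) has_integral 0) {0..pi}"
  "((\<lambda>t. sin t * sin t) has_integral pi / 2) {0..pi}"
proof -
  let ?F = "\<lambda>t. (sin (real (n + 1) * t) / real (n + 1) - sin (real (n + 3) * t) / real (n + 3)) / 2"
  have "((\<lambda>t. sin (real (n + 2) * t) * sin t) has_integral (?F pi - ?F 0)) {0..pi}"
  proof (rule fundamental_theorem_of_calculus)
    fix t :: real
    have "cos (real (n + 1) * t) = cos (real (n + 2) * t - t)" "cos (real (n + 3) * t) = cos (real (n + 2) * t + t)"
      by (simp_all add: algebra_simps)
    then have c: "(cos (real (n + 1) * t) - cos (real (n + 3) * t)) / 2 = sin (real (n + 2) * t) * sin t"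
      unfolding cos_add cos_diff by simp
    have d: "((\<lambda>t. sin (real m * t) / real m) has_real_derivative cos (real m * t)) (at t within {0..pi})"
      if "m > 0" for m
      using that by (auto intro!: derivative_eq_intros)
    have "(?F has_real_derivative (cos (real (n + 1) * t) - cos (real (n + 3) * t)) / 2) (at t within {0..pi})"
      by (intro DERIV_cdivide DERIV_diff d) simp_all
    then show "(?F has_vector_derivative sin (real (n + 2) * t) * sin t) (at t within {0..pi})"
      unfolding c has_real_derivative_iff_has_vector_derivative .
  qed simp
  moreover have "sin (real m * pi) = 0" for m
    by (rule sin_npi)
  ultimately show "((\<lambda>t. sin (real (n + 2) * t) * sin t) has_integral 0) {0..pi}"
    by (simp only: mult_zero_right sin_zero div_0 diff_self)
  let ?G = "\<lambda>t. (t - sin t * cos t) / 2"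
  have "((\<lambda>t. sin t * sin t) has_integral (?G pi - ?G 0)) {0..pi}"
  proof (rule fundamental_theorem_of_calculus)
    fix t :: real
    have "(?G has_real_derivative (1 - (sin t * (- sin t) + cos t * cos t)) / 2) (at t within {0..pi})"
      by (auto intro!: derivative_eq_intros)
    also have "(1 - (sin t * (- sin t) + cos t * cos t)) / 2 = sin t * sin t"
      using sin_cos_squared_add[of t] by (simp add: power2_eq_square)
    finally show "(?G has_vector_derivative sin t * sin t) (at t within {0..pi})"
      unfolding has_real_derivative_iff_has_vector_derivative .
  qed simp
  then show "((\<lambda>t. sin t * sin t) has_integral pi / 2) {0..pi}"
    by simp
qed

text \<open>Two uses of \<open>two_cos_sin\<close> express the product with
  \<open>4 * (cos t)^2\<close> by neighbouring sines; the combination is chosen to cancel the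
  denominator of \<open>poisson_integral\<close>.\<close>

lemma four_term:
  "(5 * sin (real (n + 2) * t) - 2 * sin (real (n + 4) * t) - 2 * sin (real n * t))
    = sin (real (n + 2) * t) * (9 - 8 * (cos t)^2)"
proof -
  let ?s = "\<lambda>n. sin (real n * t)"
  have "2 * cos t * ?s (n + 3) = ?s (n + 4) + ?s (n + 2)" "2 * cos t * ?s (n + 2) = ?s (n + 3) + ?s (n + 1)"
     "2 * cos t * ?s (n + 1) = ?s (n + 2) + ?s n"
    using two_cos_sin[of t "n + 2"] two_cos_sin[of t "n + 1"] two_cos_sin[of t n]
    by (simp_all add: eval_nat_numeral)
  then have "(2 * cos t) * (2 * cos t * ?s (n + 2)) = ?s (n + 4) + 2 * ?s (n + 2) + ?s n"
    by (simp add: distrib_left)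
  then have "4 * (cos t)^2 * ?s (n + 2) = ?s (n + 4) + 2 * ?s (n + 2) + ?s n"
    by (simp add: power2_eq_square)
  then show ?thesis
    by (simp add: algebra_simps)
qed

text \<open>Once the denominator cancels, orthogonality of the sines leaves zero. In steps of two
  the characteristic roots are 2 and 1/2.\<close>

lemma poisson_recurrence:
  "5 * poisson_integral (n + 2) - 2 * poisson_integral (n + 4) - 2 * poisson_integral n = 0"
proof -
  let ?h = "\<lambda>n t. sin (real n * t) * sin t / (9 - 8 * (cos t)^2)"
  have hi: "((\<lambda>t. 5 * ?h (n + 2) t - 2 * ?h (n + 4) t - 2 * ?h n t) has_integral
      (5 * poisson_integral (n + 2) - 2 * poisson_integral (n + 4) - 2 * poisson_integral n)) {0..pi}"
    unfolding poisson_integral_def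
    by (intro has_integral_diff has_integral_mult_right integrable_integral poisson_integrable)
  have eq: "5 * ?h (n + 2) t - 2 * ?h (n + 4) t - 2 * ?h n t = sin (real (n + 2) * t) * sin t" for t
  proof -
    have "5 * ?h (n + 2) t - 2 * ?h (n + 4) t - 2 * ?h n t
       = (5 * sin (real (n + 2) * t) - 2 * sin (real (n + 4) * t) - 2 * sin (real n * t)) * sin t / (9 - 8 * (cos t)^2)"
      by (simp only: diff_divide_distrib left_diff_distrib times_divide_eq_right mult.assoc)
    then show ?thesis
      unfolding four_term using poisson_denominator[of t] by simp
  qed
  show ?thesis
    by (rule has_integral_unique[OF hi[unfolded eq] sin_product_integral(1)])
qed

text \<open>By the recurrence the defect of this identity doubles from \<^term>\<open>n\<close> to
  \<^term>\<open>n + 2\<close>, but it is bounded.\<close>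

lemma poisson_ratio: "poisson_integral (n + 2) = poisson_integral n / 2"
proof -
  define J where "J m = poisson_integral (m + 2) - poisson_integral m / 2" for m
  have step: "J (m + 2) = 2 * J m" for m
    using poisson_recurrence[of m] unfolding J_def by (simp add: field_simps eval_nat_numeral)
  have pow: "J (n + 2 * k) = 2 ^ k * J n" for k
  proof (induction k)
    case (Suc k)
    then show ?case using step[of "n + 2 * k"] by simp
  qed simp
  have bd: "\<bar>J m\<bar> \<le> 2 * pi" for m
    using poisson_integral_bound[of "m + 2"] poisson_integral_bound[of m] unfolding J_def by linarith
  have "J n = 0"
  proof (rule ccontr)
    assume "J n \<noteq> 0"
    then obtain k where "2 * pi / \<bar>J n\<bar> < 2 ^ k"
      using real_arch_pow[of 2] by auto
    then have "2 * pi < \<bar>J (n + 2 * k)\<bar>"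
      using \<open>J n \<noteq> 0\<close> unfolding pow by (simp add: abs_mult divide_less_eq)
    then show False
      using bd[of "n + 2 * k"] by linarith
  qed
  then show ?thesis
    unfolding J_def by simp
qed

text \<open>This is the recurrence continued to \<open>n = -1\<close>: the sine of \<open>-t\<close>
  turns the 5 into 7, and the right side becomes the integral of \<open>sin t * sin t\<close>. By
  \<open>poisson_ratio\<close>, \<open>6 * poisson_integral 1 = pi / 2\<close> remains.\<close>

lemma poisson_integral_1: "poisson_integral 1 = pi / 12"
proof -
  let ?h = "\<lambda>n t. sin (real n * t) * sin t / (9 - 8 * (cos t)^2)"
  have hi: "((\<lambda>t. 7 * ?h 1 t - 2 * ?h 3 t) has_integral
      (7 * poisson_integral 1 - 2 * poisson_integral 3)) {0..pi}"
    unfolding poisson_integral_def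
    by (intro has_integral_diff has_integral_mult_right integrable_integral poisson_integrable)
  have eq: "7 * ?h 1 t - 2 * ?h 3 t = sin t * sin t" for t
  proof -
    have "sin (3 * t) = 2 * cos t * (2 * cos t * sin t) - sin t"
      using two_cos_sin[of t 1] sin_double[of t] by (simp add: ac_simps)
    then have "7 * sin t - 2 * sin (3 * t) = sin t * (9 - 8 * (cos t)^2)"
      by (simp add: algebra_simps power2_eq_square)
    moreover have "7 * ?h 1 t - 2 * ?h 3 t = (7 * sin t - 2 * sin (3 * t)) * sin t / (9 - 8 * (cos t)^2)"
      by (simp add: diff_divide_distrib left_diff_distrib)
    ultimately show ?thesis
      using poisson_denominator[of t] by simp
  qed
  have "7 * poisson_integral 1 - 2 * poisson_integral 3 = pi / 2"
    by (rule has_integral_unique[OF hi[unfolded eq] sin_product_integral(2)])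
  then show ?thesis
    using poisson_ratio[of 1] by (simp add: eval_nat_numeral)
qed

text \<open>The substitution \<open>2 * sqrt 2 * cos t\<close> turns the square root into a sine;
  the constant is \<open>8 * 3 / (2*pi)\<close>.\<close>

lemma rho3_substitution:
  "integral {-2 * sqrt 2..2 * sqrt 2} (\<lambda>t. poly f t * rho3 t)
    = 12 / pi * integral {0..pi} (\<lambda>t. poly f (2 * sqrt 2 * cos t) * (sin t)^2 / (9 - 8 * (cos t)^2))"
proof -
  define r where "r = 2 * sqrt 2"
  have r: "r^2 = 8" "r > 0"
    unfolding r_def by (simp_all add: power_mult_distrib)
  define F where "F = (\<lambda>t. poly f t * (3 / (2*pi) * sqrt (8 - t^2) / (9 - t^2)))"
  have sq: "t^2 \<le> 8" if "t \<in> {-r..r}" for t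
    using that r by (metis abs_le_iff abs_le_square_iff abs_of_pos atLeastAtMost_iff minus_le_iff)
  have "continuous_on {-r..r} F"
    unfolding F_def using sq by (intro continuous_intros) force
  moreover have "(\<lambda>t. r * cos t) ` {0..pi} \<subseteq> {-r..r}"
    using r mult_left_mono[of "cos _" 1 r] mult_left_mono[of "-1" "cos _" r] by auto
  \<comment> \<open>The substitution is decreasing: the first integral runs over an empty interval,
    and the second appears with a minus sign that is negated below.\<close>
  ultimately have sub: "((\<lambda>t. (- r * sin t) *\<^sub>R F (r * cos t)) has_integral
      (integral {r * cos 0..r * cos pi} F - integral {r * cos pi..r * cos 0} F)) {0..pi}"
    using r by (intro has_integral_substitution_general[of "{}" 0 pi _ "-r" r F])
      (auto intro!: continuous_intros derivative_eq_intros)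
  have "((\<lambda>t. - ((- r * sin t) *\<^sub>R F (r * cos t))) has_integral integral {-r..r} F) {0..pi}"
    using has_integral_neg[OF sub] r by simp
  moreover have "- ((- r * sin t) *\<^sub>R F (r * cos t))
      = 12 / pi * (poly f (r * cos t) * (sin t)^2 / (9 - 8 * (cos t)^2))" if "t \<in> {0..pi}" for t
  proof -
    have "8 - (r * cos t)^2 = (r * sin t)^2"
      using r by (simp add: power_mult_distrib sin_squared_eq algebra_simps)
    moreover have "r * sin t \<ge> 0"
      using r that sin_ge_zero by simp
    ultimately have e1: "sqrt (8 - (r * cos t)^2) = r * sin t"
      by simp
    have e2: "9 - (r * cos t)^2 = 9 - 8 * (cos t)^2"
      using r by (simp add: power_mult_distrib)
    have "- ((- r * sin t) *\<^sub>R F (r * cos t))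
        = r^2 * (3 / (2*pi)) * (poly f (r * cos t) * (sin t)^2 / (9 - 8 * (cos t)^2))"
      unfolding F_def e1 e2 by (simp add: power2_eq_square)
    then show ?thesis
      unfolding r by simp
  qed
  ultimately have "((\<lambda>t. 12 / pi * (poly f (r * cos t) * (sin t)^2 / (9 - 8 * (cos t)^2)))
      has_integral integral {-r..r} F) {0..pi}"
    by (rule has_integral_eq[rotated])
  from integral_unique[OF this]
  have "integral {-r..r} F
      = 12 / pi * integral {0..pi} (\<lambda>t. poly f (r * cos t) * (sin t)^2 / (9 - 8 * (cos t)^2))"
    by (simp only: Henstock_Kurzweil_Integration.integral_mult_right)
  moreover have "integral {-r..r} F = integral {-r..r} (\<lambda>t. poly f t * rho3 t)"
    by (rule integral_cong) (simp add: F_def rho3_def r_def)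
  ultimately show ?thesis
    unfolding r_def by simp
qed

text \<open>For positive \<open>k\<close> the integral is a multiple of a difference that vanishes
  by \<open>poisson_ratio\<close>; for \<open>k = 0\<close> it is
  \<open>12 / pi * (pi / 12)\<close>.\<close>

theorem integral_km_rho3:
  "integral {-2 * sqrt 2..2 * sqrt 2} (\<lambda>t. poly (km_poly k) t * rho3 t) = (if k = 0 then 1 else 0)"
proof (cases k)
  case 0
  have "(\<lambda>t. poly (km_poly 0) (2 * sqrt 2 * cos t) * (sin t)^2 / (9 - 8 * (cos t)^2))
      = (\<lambda>t. sin (real 1 * t) * sin t / (9 - 8 * (cos t)^2))"
    by (simp add: power2_eq_square)
  then show ?thesis
    unfolding 0 rho3_substitution using poisson_integral_1 unfolding poisson_integral_def by simp
next
  case (Suc m)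
  let ?h = "\<lambda>n t. sin (real n * t) * sin t / (9 - 8 * (cos t)^2)"
  have integrand: "poly (km_poly k) (2 * sqrt 2 * cos t) * (sin t)^2 / (9 - 8 * (cos t)^2)
      = sqrt 2 ^ Suc m * (?h (m + 2) t - ?h m t / 2)" for t
  proof -
    have gen: "q * (A - B / 2) * s / D = q * (A * s / D - B * s / D / 2)" for q A B s D :: real
      by (simp add: algebra_simps diff_divide_distrib)
    have "poly (km_poly k) (2 * sqrt 2 * cos t) * (sin t)^2
        = (sqrt 2 ^ Suc m * (sin (real (m + 2) * t) - sin (real m * t) / 2)) * sin t"
      unfolding Suc km_trig[symmetric] by (simp add: power2_eq_square)
    then show ?thesis
      unfolding gen[symmetric] by (rule arg_cong)
  qed
  have hi: "((\<lambda>t. sqrt 2 ^ Suc m * (?h (m + 2) t - ?h m t / 2)) has_integral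
      sqrt 2 ^ Suc m * (poisson_integral (m + 2) - poisson_integral m / 2)) {0..pi}"
    unfolding poisson_integral_def
    by (intro has_integral_diff has_integral_mult_right has_integral_divide integrable_integral poisson_integrable)
  have "sqrt 2 ^ Suc m * (poisson_integral (m + 2) - poisson_integral m / 2) = 0"
    unfolding poisson_ratio by simp
  with integral_unique[OF hi] show ?thesis
    unfolding rho3_substitution integrand using Suc by simp
qed

section \<open>The discrepancy\<close>

lemma degree_lead_coeff_km: "degree (km_poly k) = k \<and> lead_coeff (km_poly k) = 1"
proof (induction k rule: km_poly.induct)
  case (4 k)
  have d: "degree ([:0, 1:] * km_poly (Suc (Suc k))) = Suc (Suc (Suc k))"
    "lead_coeff ([:0, 1:] * km_poly (Suc (Suc k))) = 1"
    using 4(1) by (auto simp: degree_pCons_eq_if)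
  have "degree ([:2:] * km_poly (Suc k)) < degree ([:0, 1:] * km_poly (Suc (Suc k)))"
    unfolding d using 4(2) by simp
  from degree_lead_coeff_diff[OF this, folded km_poly.simps(4)] d show ?case
    by (intro conjI) (metis, metis)
qed simp_all

text \<open>The \<open>km_poly\<close> are monic, one in each degree, so subtracting a multiple of
  one of them lowers the degree of any nonconstant polynomial and leaves zero from a
  constant.\<close>

lemma km_poly_induct [case_names km_poly add smult]:
  assumes km_poly: "\<And>k. P (km_poly k)"
    and add: "\<And>f g. P f \<Longrightarrow> P g \<Longrightarrow> P (f + g)"
    and smult: "\<And>c f. P f \<Longrightarrow> P (Polynomial.smult c f)"
  shows "P f"
proof (induction "degree f" arbitrary: f rule: less_induct)
  case less
  define n where "n = degree f"
  define g where "g = f - Polynomial.smult (lead_coeff f) (km_poly n)"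
  have f: "f = g + Polynomial.smult (lead_coeff f) (km_poly n)"
    unfolding g_def by simp
  have "P g"
  proof (cases "g = 0")
    case True
    \<comment> \<open>The zero polynomial is reached as the zero multiple of
      \<open>km_poly 0\<close>.\<close>
    then show ?thesis
      using smult[OF km_poly[of 0], of 0] by simp
  next
    case False
    have "coeff (km_poly n) n = 1"
      using degree_lead_coeff_km[of n] by metis
    then have "coeff g n = 0"
      unfolding g_def by (simp add: n_def[symmetric])
    moreover have "degree g \<le> n"
      unfolding g_def using degree_lead_coeff_km[of n] n_def
      by (intro degree_diff_le) (auto intro: order.trans[OF degree_smult_le])
    ultimately have "degree g < n"
      using False by (metis leading_coeff_0_iff order_le_imp_less_or_eq)
    then show ?thesis
      using less n_def by simp
  qed
  then show ?case
    using add smult km_poly f by metis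
qed

definition discrepancy :: "int \<Rightarrow> real poly \<Rightarrow> real" where
  "discrepancy p f = eig_sum (markoff_adj p) (poly f) / real (card (markoff p))
     - integral {-2 * sqrt 2..2 * sqrt 2} (\<lambda>t. poly f t * rho3 t)"

lemma rho3_poly_integrable:
  "(\<lambda>t. poly f t * rho3 t) integrable_on {-2 * sqrt 2..2 * sqrt 2}"
proof -
  have "t^2 < 9" if "t \<in> {-2 * sqrt 2..2 * sqrt 2}" for t
  proof -
    have "\<bar>t\<bar> \<le> \<bar>2 * sqrt 2\<bar>"
      using that by auto
    then have "t^2 \<le> (2 * sqrt 2)^2"
      by (simp only: abs_le_square_iff)
    then show ?thesis
      by (simp add: power_mult_distrib)
  qed
  then have "(\<lambda>t. poly f t * (3 / (2*pi) * sqrt (8 - t^2) / (9 - t^2))) integrable_on {-2 * sqrt 2..2 * sqrt 2}"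
    by (intro integrable_continuous_real continuous_intros) force
  then show ?thesis
    by (rule integrable_eq) (simp add: rho3_def)
qed

lemma discrepancy_linear:
  "discrepancy p (f + g) = discrepancy p f + discrepancy p g"
  "discrepancy p (Polynomial.smult c f) = c * discrepancy p f"
proof -
  have "integral {-2 * sqrt 2..2 * sqrt 2} (\<lambda>t. poly (f + g) t * rho3 t)
      = integral {-2 * sqrt 2..2 * sqrt 2} (\<lambda>t. poly f t * rho3 t)
        + integral {-2 * sqrt 2..2 * sqrt 2} (\<lambda>t. poly g t * rho3 t)"
    unfolding poly_add distrib_right by (intro integral_add rho3_poly_integrable)
  then show "discrepancy p (f + g) = discrepancy p f + discrepancy p g"
    unfolding discrepancy_def eig_sum_poly_linear by (simp add: add_divide_distrib)
  show "discrepancy p (Polynomial.smult c f) = c * discrepancy p f"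
    unfolding discrepancy_def eig_sum_poly_linear poly_smult mult.assoc
      Henstock_Kurzweil_Integration.integral_mult_right by (simp add: right_diff_distrib)
qed

lemma card_markoff_quadratic:
  assumes "prime p" "p \<ge> 5"
  shows "(real_of_int p)^2 \<le> 4 * real (card (markoff p))"
proof -
  \<comment> \<open>\<open>4 * ((p - 1) * (p - 3)) - p^2\<close> exceeds this product by 7.\<close>
  have "0 \<le> (p - 5) * (3 * p - 1)"
    using assms(2) by (intro mult_nonneg_nonneg) auto
  then have "p^2 \<le> 4 * ((p - 1) * (p - 3))"
    by (simp add: algebra_simps power2_eq_square)
  also have "\<dots> \<le> 4 * int (card (markoff p))"
    using card_markoff_lower[OF assms(1)] by simp
  finally have "real_of_int (p^2) \<le> real_of_int (4 * int (card (markoff p)))"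
    by (simp only: of_int_le_iff)
  then show ?thesis
    by simp
qed

lemma discrepancy_km_0:
  assumes p: "prime p"
  shows "\<bar>discrepancy p (km_poly 0)\<bar> \<le> 5 / real_of_int p"
proof -
  have p1: "p > 1"
    using p by (rule prime_gt_1_int)
  have E: "eig_sum (markoff_adj p) (poly (km_poly 0)) = real (card (markoff p))"
    unfolding eig_sum_km reduced_0 by (simp add: word_action_def)
  show ?thesis
  proof (cases "card (markoff p) = 0")
    \<comment> \<open>Without vertices the quotient is 0 by convention and the discrepancy is
      \<open>-1\<close>. The surface is indeed empty for \<open>p = 3\<close>; the constant 5
      absorbs the primes below 5.\<close>
    case True
    then have "p < 5"
      using card_markoff_quadratic[OF p] p1 by fastforce
    then have "1 \<le> 5 / real_of_int p"
      using p1 by simp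
    then show ?thesis
      unfolding discrepancy_def E integral_km_rho3 True by simp
  next
    case False
    then show ?thesis
      unfolding discrepancy_def E integral_km_rho3 using p1 by simp
  qed
qed

text \<open>For \<open>p \<ge> 5\<close> a word fixes at most \<open>K * p\<close> of at least
  \<open>p^2 / 4\<close> vertices, which gives \<open>4 * K / p\<close> for each word.\<close>

lemma discrepancy_km_Suc:
  assumes p: "prime p"
  shows "\<bar>discrepancy p (km_poly (Suc k))\<bar>
    \<le> real (card (reduced (Suc k))) * (4 * (6 + 3 * 2 ^ Suc k)) / real_of_int p"
proof -
  have p1: "p > 1"
    using p by (rule prime_gt_1_int)
  define N where "N = real (card (markoff p))"
  define K :: real where "K = 6 + 3 * 2 ^ Suc k"
  define c where "c = (\<lambda>w. real (card {u\<in>markoff p. word_action p w u = u}))"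
  have K: "K \<ge> 6"
    unfolding K_def by simp
  have bound: "c w / N \<le> 4 * K / real_of_int p" if w: "w \<in> reduced (Suc k)" for w
  proof (cases "p \<ge> 5")
    case True
    have N: "(real_of_int p)^2 \<le> 4 * N"
      unfolding N_def by (rule card_markoff_quadratic[OF p True])
    moreover have "0 < (real_of_int p)^2"
      using p1 by simp
    ultimately have N0: "N > 0"
      by linarith
    have "card {u\<in>markoff p. word_action p w u = u} \<le> (6 + 3 * 2 ^ length w) * nat p"
      using w by (intro card_fixed_points[OF p]) (auto simp: reduced_def)
    then have "c w \<le> real ((6 + 3 * 2 ^ length w) * nat p)"
      unfolding c_def by (simp only: of_nat_le_iff)
    also have "\<dots> = K * real_of_int p"
      unfolding K_def using w p1 by (simp add: reduced_def)
    finally have "c w * real_of_int p \<le> K * (real_of_int p)^2"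
      using p1 by (simp add: power2_eq_square mult.assoc[symmetric])
    also have "\<dots> \<le> K * (4 * N)"
      using N K by (intro mult_left_mono) auto
    finally show ?thesis
      using N0 p1 by (simp add: field_simps)
  next
    \<comment> \<open>For primes below 5 the fraction of fixed points is at most 1, also under
      division by zero, while \<open>4 * K\<close> is at least 24.\<close>
    case False
    have "c w \<le> N"
      unfolding c_def N_def using finite_markoff by (intro of_nat_mono card_mono) auto
    then have "c w / N \<le> 1"
      unfolding N_def by (cases "card (markoff p) = 0") (simp_all add: divide_le_eq_1)
    also have "1 \<le> 4 * K / real_of_int p"
      using False K p1 by simp
    finally show ?thesis .
  qed
  have "discrepancy p (km_poly (Suc k)) = (\<Sum>w\<in>reduced (Suc k). c w / N)"
    unfolding discrepancy_def eig_sum_km integral_km_rho3 c_def N_def by (simp add: sum_divide_distrib)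
  moreover have "(\<Sum>w\<in>reduced (Suc k). c w / N) \<le> (\<Sum>w\<in>reduced (Suc k). 4 * K / real_of_int p)"
    by (intro sum_mono bound)
  moreover have "0 \<le> (\<Sum>w\<in>reduced (Suc k). c w / N)"
    unfolding c_def N_def by (intro sum_nonneg) simp
  ultimately show ?thesis
    unfolding K_def by simp
qed

theorem theorem1p2:
  fixes f :: "real poly"
  shows "\<exists>C::real. \<forall>p::int. prime p \<and> odd p \<longrightarrow>
    \<bar>eig_sum (markoff_adj p) (poly f) / real (card (markoff p))
      - integral {-2 * sqrt 2..2 * sqrt 2} (\<lambda>t. poly f t * rho3 t)\<bar> \<le> C / real_of_int p"
  unfolding discrepancy_def[symmetric]
proof (induction f rule: km_poly_induct)
  case (km_poly k)
  show ?case
    using discrepancy_km_0 discrepancy_km_Suc by (cases k) blast+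
next
  case (add f g)
  then obtain C D where C: "\<forall>p. prime p \<and> odd p \<longrightarrow> \<bar>discrepancy p f\<bar> \<le> C / real_of_int p"
    and D: "\<forall>p. prime p \<and> odd p \<longrightarrow> \<bar>discrepancy p g\<bar> \<le> D / real_of_int p"
    by blast
  show ?case
  proof (intro exI[of _ "C + D"] allI impI)
    fix p :: int assume p: "prime p \<and> odd p"
    have "\<bar>discrepancy p f + discrepancy p g\<bar> \<le> \<bar>discrepancy p f\<bar> + \<bar>discrepancy p g\<bar>"
      by (rule abs_triangle_ineq)
    also have "\<dots> \<le> C / real_of_int p + D / real_of_int p"
      using C D p by (intro add_mono) blast+
    finally show "\<bar>discrepancy p (f + g)\<bar> \<le> (C + D) / real_of_int p"
      unfolding discrepancy_linear add_divide_distrib .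
  qed
next
  case (smult c f)
  then obtain C where C: "\<forall>p. prime p \<and> odd p \<longrightarrow> \<bar>discrepancy p f\<bar> \<le> C / real_of_int p"
    by blast
  show ?case
  proof (intro exI[of _ "\<bar>c\<bar> * C"] allI impI)
    fix p :: int assume "prime p \<and> odd p"
    then have "\<bar>c\<bar> * \<bar>discrepancy p f\<bar> \<le> \<bar>c\<bar> * (C / real_of_int p)"
      using C by (intro mult_left_mono) simp_all
    then show "\<bar>discrepancy p (Polynomial.smult c f)\<bar> \<le> \<bar>c\<bar> * C / real_of_int p"
      unfolding discrepancy_linear abs_mult times_divide_eq_right .
  qed
qed

end
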